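(* Let $X$ and $Y$ be complex infinite-dimensional Banach spaces, $A\in B(X)$, $B\in B(Y)$, $C\in B(Y,X)$, and let $M_C=\begin{pmatrix}A&C\\0&B\end{pmatrix}\in B(X\oplus Y)$. If $\sigma_*=\sigma_{sw}$ or $\sigma_*=\sigma_{rw}$, then $$\sigma_*(M_C)\cup\bigl(S(A)\cap S(B^* )\bigr)\cup S(B)=\sigma_*(A)\cup\sigma_*(B)\cup\bigl(S(A)\cap S(B^* )\bigr)\cup S(B).$$
   Context: $B(Y,X)$ is the set of bounded linear operators from $Y$ to $X$, and $B(X)=B(X,X)$. $T^*$ denotes the dual operator of $T$ acting on the dual space. For $T\in B(X)$ let $\alpha(T)=\dim N(T)$ and $\beta(T)=\dim X/R(T)$, where $N(T)$ and $R(T)$ are the kernel and range; for semi-Fredholm $T$, $\mathrm{ind}(T)=\alpha(T)-\beta(T)$. $\Phi_-(X)=\{T:\beta(T)<\infty\}$; $\Phi_r(X)=\{T: N(T)\text{ is a closed and complemented subspace of }X\text{ and }\beta(T)<\infty\}$; $\Phi_-^+(X)=\{T\in\Phi_-(X):\mathrm{ind}(T)\ge 0\}$; $\Phi_{rw}(X)=\{T\in\Phi_r(X):\mathrm{ind}(T)\ge 0\}$. The lower semi-Weyl spectrum is $\sigma_{sw}(T)=\{\lambda\in\mathbb{C}:T-\lambda I\notin\Phi_-^+(X)\}$ and the right semi-Weyl spectrum is $\sigma_{rw}(T)=\{\lambda\in\mathbb{C}:T-\lambda I\notin\Phi_{rw}(X)\}$; similarly on $Y$ and $X\oplus Y$.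 $T$ has the single valued extension property (SVEP) at $\lambda\in\mathbb{C}$ if there is $r>0$ such that for every open subset $V$ of the open disc $D(\lambda,r)$, the function $f\equiv 0$ is the only analytic solution of $(T-\mu)f(\mu)=0$ for all $\mu\in V$. $S(T)=\{\lambda\in\mathbb{C}: T\text{ fails to have the SVEP at }\lambda\}$. *)

theory Defs
  imports "HOL-Analysis.Analysis"
begin

section \<open>Complex normed and Banach spaces\<close>

class scaleC =
  fixes scaleC :: "complex \<Rightarrow> 'a \<Rightarrow> 'a"  (infixr "*\<^sub>C" 75)

class complex_normed_vector = real_normed_vector + scaleC +
  assumes scaleC_add_right: "a *\<^sub>C (x + y) = a *\<^sub>C x + a *\<^sub>C y"
    and scaleC_add_left: "(a + b) *\<^sub>C x = a *\<^sub>C x + b *\<^sub>C x"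
    and scaleC_scaleC: "a *\<^sub>C b *\<^sub>C x = (a * b) *\<^sub>C x"
    and scaleC_one: "1 *\<^sub>C x = x"
    and scaleR_scaleC: "r *\<^sub>R x = complex_of_real r *\<^sub>C x"
    and norm_scaleC: "norm (a *\<^sub>C x) = cmod a * norm x"

class complex_banach = complex_normed_vector + banach

global_interpretation complex_vector:
  vector_space "scaleC :: complex \<Rightarrow> 'a \<Rightarrow> 'a::complex_normed_vector"
  by unfold_locales
    (simp_all add: scaleC_add_right scaleC_add_left scaleC_scaleC scaleC_one)

instantiation complex :: complex_banach
begin

definition scaleC_complex :: "complex \<Rightarrow> complex \<Rightarrow> complex"
  where "scaleC_complex a x = a * x"

instance
  by standard
    (simp_all add: scaleC_complex_def algebra_simps norm_mult scaleR_conv_of_real)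

end

text \<open>The direct sum of \<open>X\<close> and \<open>Y\<close> is the product type; the library puts on it
  the equivalent norm \<open>sqrt ((norm x)\<^sup>2 + (norm y)\<^sup>2)\<close>.\<close>

instantiation prod :: (complex_normed_vector, complex_normed_vector) complex_normed_vector
begin

definition scaleC_prod :: "complex \<Rightarrow> 'a \<times> 'b \<Rightarrow> 'a \<times> 'b"
  where "scaleC_prod a p = (a *\<^sub>C fst p, a *\<^sub>C snd p)"

instance
proof
  fix a b :: complex and x y :: "'a \<times> 'b" and r :: real
  show "a *\<^sub>C (x + y) = a *\<^sub>C x + a *\<^sub>C y" "(a + b) *\<^sub>C x = a *\<^sub>C x + b *\<^sub>C x"
    "a *\<^sub>C b *\<^sub>C x = (a * b) *\<^sub>C x" "1 *\<^sub>C x = x" "r *\<^sub>R x = complex_of_real r *\<^sub>C x"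
    by (simp_all add: scaleC_prod_def scaleC_add_right scaleC_add_left scaleC_scaleC scaleC_one
        prod_eq_iff scaleR_scaleC)
  have "norm (a *\<^sub>C x) = sqrt ((cmod a)\<^sup>2 * ((norm (fst x))\<^sup>2 + (norm (snd x))\<^sup>2))"
    by (simp add: scaleC_prod_def norm_prod_def norm_scaleC power_mult_distrib distrib_left)
  also have "\<dots> = cmod a * norm x"
    by (simp add: norm_prod_def real_sqrt_mult)
  finally show "norm (a *\<^sub>C x) = cmod a * norm x" .
qed

end

instance prod :: (complex_banach, complex_banach) complex_banach ..

section \<open>Bounded operators and the dual space\<close>

definition bounded_clinear ::
    "('a::complex_normed_vector \<Rightarrow> 'b::complex_normed_vector) \<Rightarrow> bool"
  where "bounded_clinear f \<longleftrightarrow> bounded_linear f \<and> (\<forall>a x. f (a *\<^sub>C x) = a *\<^sub>C f x)"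

text \<open>The dual space consists of the bounded complex-linear functionals, with the operator
  norm inherited from \<open>blinfun\<close>. (Restricting scalars to the reals does not change this norm.)\<close>

typedef (overloaded) 'a cdual =
  "{f :: 'a::complex_normed_vector \<Rightarrow>\<^sub>L complex. bounded_clinear (blinfun_apply f)}"
  morphisms blinfun_of_cdual Abs_cdual
proof
  show "0 \<in> {f :: 'a \<Rightarrow>\<^sub>L complex. bounded_clinear (blinfun_apply f)}"
    by (simp add: bounded_clinear_def blinfun.bounded_linear_right scaleC_complex_def)
qed

setup_lifting type_definition_cdual

lemma bounded_clinear_blinfun_iff:
  fixes f :: "'a::complex_normed_vector \<Rightarrow>\<^sub>L complex"
  shows "bounded_clinear (blinfun_apply f) \<longleftrightarrow>
    (\<forall>a x. blinfun_apply f (a *\<^sub>C x) = a * blinfun_apply f x)"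
  by (simp add: bounded_clinear_def blinfun.bounded_linear_right scaleC_complex_def)

lift_definition cdual_apply :: "'a::complex_normed_vector cdual \<Rightarrow> 'a \<Rightarrow> complex"
  is blinfun_apply .

lemma scaleC_blinfun_bounded_linear:
  fixes f :: "'a::complex_normed_vector \<Rightarrow>\<^sub>L complex"
  shows "bounded_linear (\<lambda>x. c * blinfun_apply f x)"
  by (intro bounded_linear_const_mult blinfun.bounded_linear_right)

instantiation cdual :: (complex_normed_vector) complex_normed_vector
begin

lift_definition norm_cdual :: "'a cdual \<Rightarrow> real" is norm .

lift_definition minus_cdual :: "'a cdual \<Rightarrow> 'a cdual \<Rightarrow> 'a cdual" is minus
  by (simp add: bounded_clinear_blinfun_iff blinfun.bilinear_simps right_diff_distrib)

definition dist_cdual :: "'a cdual \<Rightarrow> 'a cdual \<Rightarrow> real"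
  where "dist_cdual f g = norm (f - g)"

definition uniformity_cdual :: "('a cdual \<times> 'a cdual) filter"
  where [code del]:
    "uniformity_cdual = (INF e\<in>{0 <..}. principal {(x :: 'a cdual, y). dist x y < e})"

definition open_cdual :: "'a cdual set \<Rightarrow> bool"
  where [code del]:
    "open_cdual S = (\<forall>x\<in>S. \<forall>\<^sub>F (x', y) in uniformity. x' = x \<longrightarrow> y \<in> S)"

lift_definition uminus_cdual :: "'a cdual \<Rightarrow> 'a cdual" is uminus
  by (simp add: bounded_clinear_blinfun_iff blinfun.bilinear_simps)

lift_definition zero_cdual :: "'a cdual" is 0
  by (simp add: bounded_clinear_blinfun_iff)

lift_definition plus_cdual :: "'a cdual \<Rightarrow> 'a cdual \<Rightarrow> 'a cdual" is plus
  by (simp add: bounded_clinear_blinfun_iff blinfun.bilinear_simps distrib_left)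

lift_definition scaleR_cdual :: "real \<Rightarrow> 'a cdual \<Rightarrow> 'a cdual" is scaleR
  by (simp add: bounded_clinear_blinfun_iff blinfun.bilinear_simps)

lift_definition scaleC_cdual :: "complex \<Rightarrow> 'a cdual \<Rightarrow> 'a cdual"
  is "\<lambda>c f. Blinfun (\<lambda>x. c * blinfun_apply f x)"
  unfolding bounded_clinear_blinfun_iff
  by (simp add: bounded_linear_Blinfun_apply scaleC_blinfun_bounded_linear)

definition sgn_cdual :: "'a cdual \<Rightarrow> 'a cdual"
  where "sgn_cdual f = inverse (norm f) *\<^sub>R f"

instance
proof
  fix x y z :: "'a cdual" and a b :: complex and r s :: real
  show "x + y + z = x + (y + z)" "x + y = y + x" "0 + x = x" "- x + x = 0" "x - y = x + - y"
    "r *\<^sub>R (x + y) = r *\<^sub>R x + r *\<^sub>R y" "(r + s) *\<^sub>R x = r *\<^sub>R x + s *\<^sub>R x"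
    "r *\<^sub>R s *\<^sub>R x = (r * s) *\<^sub>R x" "1 *\<^sub>R x = x" "(norm x = 0) = (x = 0)"
    "norm (x + y) \<le> norm x + norm y" "norm (r *\<^sub>R x) = \<bar>r\<bar> * norm x"
    by (transfer, simp add: algebra_simps norm_triangle_ineq)+
  show "dist x y = norm (x - y)" by (rule dist_cdual_def)
  show "sgn x = inverse (norm x) *\<^sub>R x" by (rule sgn_cdual_def)
  show "uniformity = (INF e\<in>{0 <..}. principal {(x :: 'a cdual, y). dist x y < e})"
    by (rule uniformity_cdual_def)
  show "open U = (\<forall>x\<in>U. \<forall>\<^sub>F (x', y) in uniformity. x' = x \<longrightarrow> y \<in> U)" for U :: "'a cdual set"
    by (rule open_cdual_def)
  note scale = bounded_linear_Blinfun_apply[OF scaleC_blinfun_bounded_linear]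
  have inj: "x = y" if "\<And>t. cdual_apply x t = cdual_apply y t" for x y :: "'a cdual"
    using that by transfer (rule blinfun_eqI)
  have scale_apply: "cdual_apply (c *\<^sub>C f) t = c * cdual_apply f t" for c t and f :: "'a cdual"
    by transfer (simp add: scale)
  have plus_apply: "cdual_apply (f + g) t = cdual_apply f t + cdual_apply g t"
    for t and f g :: "'a cdual"
    by transfer (rule blinfun.add_left)
  have scaleR_apply: "cdual_apply (c *\<^sub>R f) t = complex_of_real c * cdual_apply f t"
    for c t and f :: "'a cdual"
    by transfer (simp add: blinfun.scaleR_left scaleR_conv_of_real)
  show "a *\<^sub>C (x + y) = a *\<^sub>C x + a *\<^sub>C y" "(a + b) *\<^sub>C x = a *\<^sub>C x + b *\<^sub>C x"
    "a *\<^sub>C b *\<^sub>C x = (a * b) *\<^sub>C x" "1 *\<^sub>C x = x" "r *\<^sub>R x = complex_of_real r *\<^sub>C x"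
    by (rule inj, simp add: scale_apply plus_apply scaleR_apply algebra_simps)+
  show "norm (a *\<^sub>C x) = cmod a * norm x"
  proof transfer
    fix a and x :: "'a \<Rightarrow>\<^sub>L complex"
    have le: "norm (Blinfun (\<lambda>t. c * blinfun_apply f t)) \<le> cmod c * norm f"
      for c and f :: "'a \<Rightarrow>\<^sub>L complex"
      by (rule norm_blinfun_bound)
        (simp_all add: scale norm_mult mult.assoc mult_left_mono norm_blinfun)
    show "norm (Blinfun (\<lambda>t. a * blinfun_apply x t)) = cmod a * norm x"
    proof (cases "a = 0")
      case True
      then show ?thesis using le[of 0 x] by simp
    next
      case False
      have "Blinfun (\<lambda>t. inverse a * blinfun_apply (Blinfun (\<lambda>t. a * blinfun_apply x t)) t) = x"
        using False unfolding scale mult.assoc[symmetric]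
        by (simp add: blinfun_apply_inverse)
      then have "norm x \<le> inverse (cmod a) * norm (Blinfun (\<lambda>t. a * blinfun_apply x t))"
        using le[of "inverse a" "Blinfun (\<lambda>t. a * blinfun_apply x t)"]
        by (simp add: norm_inverse)
      then show ?thesis
        using le[of a x] False by (simp add: field_simps)
    qed
  qed
qed

end

instance cdual :: (complex_normed_vector) complex_banach
proof
  fix X :: "nat \<Rightarrow> 'a cdual"
  assume "Cauchy X"
  moreover have dist_eq: "dist f g = dist (blinfun_of_cdual f) (blinfun_of_cdual g)"
    for f g :: "'a cdual"
    unfolding dist_cdual_def dist_norm by transfer simp
  ultimately have "Cauchy (\<lambda>n. blinfun_of_cdual (X n))"
    by (simp add: Cauchy_def)
  then obtain L where L: "(\<lambda>n. blinfun_of_cdual (X n)) \<longlonglongrightarrow> L"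
    using Cauchy_convergent_iff convergent_def by blast
  then have lim: "(\<lambda>n. blinfun_apply (blinfun_of_cdual (X n)) x) \<longlonglongrightarrow> blinfun_apply L x" for x
    by (intro blinfun.tendsto tendsto_const)
  have lin: "blinfun_apply (blinfun_of_cdual (X n)) (a *\<^sub>C x)
      = a * blinfun_apply (blinfun_of_cdual (X n)) x" for n a x
    using blinfun_of_cdual[of "X n"] by (simp add: bounded_clinear_blinfun_iff)
  have "blinfun_apply L (a *\<^sub>C x) = a * blinfun_apply L x" for a x
    using lim[of "a *\<^sub>C x"] tendsto_mult[OF tendsto_const[of a] lim[of x]]
    unfolding lin by (rule LIMSEQ_unique)
  then have "blinfun_of_cdual (Abs_cdual L) = L"
    by (intro Abs_cdual_inverse) (simp add: bounded_clinear_blinfun_iff)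
  then have "X \<longlonglongrightarrow> Abs_cdual L"
    using L by (simp add: tendsto_dist_iff[of _ L] tendsto_dist_iff[of X] dist_eq)
  then show "convergent X"
    by (rule convergentI)
qed

text \<open>The dual operator \<open>f \<mapsto> f \<circ> T\<close>; meaningful for \<open>bounded_clinear T\<close>.\<close>

definition dual_op ::
    "('a::complex_normed_vector \<Rightarrow> 'b::complex_normed_vector) \<Rightarrow> 'b cdual \<Rightarrow> 'a cdual"
  where "dual_op T f = Abs_cdual (Blinfun (\<lambda>x. cdual_apply f (T x)))"

lemma cdual_apply_dual_op:
  assumes "bounded_clinear T"
  shows "cdual_apply (dual_op T f) x = cdual_apply f (T x)"
proof -
  have bl: "bounded_linear (\<lambda>x. cdual_apply f (T x))"
    using assms unfolding bounded_clinear_def cdual_apply.rep_eq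
    by (intro bounded_linear_compose[OF blinfun.bounded_linear_right]) simp
  have "cdual_apply f (T (a *\<^sub>C y)) = a * cdual_apply f (T y)" for a y
    using assms blinfun_of_cdual[of f]
    by (simp add: bounded_clinear_def bounded_clinear_blinfun_iff cdual_apply.rep_eq
        scaleC_complex_def)
  then have "bounded_clinear (blinfun_apply (Blinfun (\<lambda>x. cdual_apply f (T x))))"
    unfolding bounded_clinear_blinfun_iff by (simp add: bounded_linear_Blinfun_apply[OF bl])
  then have "blinfun_of_cdual (dual_op T f) = Blinfun (\<lambda>x. cdual_apply f (T x))"
    by (simp add: dual_op_def Abs_cdual_inverse)
  then show ?thesis
    unfolding cdual_apply.rep_eq[of "dual_op T f"] by (simp only: bounded_linear_Blinfun_apply[OF bl])
qed

section \<open>Dimension, quotient dimension, index\<close>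

definition cdim :: "'a::complex_normed_vector set \<Rightarrow> enat"
  where "cdim V =
    (if \<exists>B. finite B \<and> V \<subseteq> complex_vector.span B then enat (complex_vector.dim V) else \<infinity>)"

text \<open>The quotient by a subspace \<open>M\<close>: its elements are the cosets \<open>x +o M\<close>, its zero is \<open>M\<close>,
  and its addition is addition of sets. Adding \<open>M\<close> in \<open>quot_scale\<close> and in \<open>quot_independent\<close>
  matters only for the scalar \<open>0\<close> and for the empty sum, where the set operations alone would
  give \<open>{0}\<close> instead of \<open>M\<close>.\<close>

definition quot_space :: "'a::complex_normed_vector set \<Rightarrow> 'a set set"
  where "quot_space M = range (\<lambda>x. x +o M)"

definition quot_scale :: "'a::complex_normed_vector set \<Rightarrow> complex \<Rightarrow> 'a set \<Rightarrow> 'a set"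
  where "quot_scale M a K = (scaleC a ` K) + M"

definition quot_independent :: "'a::complex_normed_vector set \<Rightarrow> 'a set set \<Rightarrow> bool"
  where "quot_independent M F \<longleftrightarrow>
    (\<forall>u. (\<Sum>K\<in>F. quot_scale M (u K) K) + M = M \<longrightarrow> (\<forall>K\<in>F. u K = 0))"

definition quot_dim :: "'a::complex_normed_vector set \<Rightarrow> enat"
  where "quot_dim M =
    Sup {enat (card F) | F. finite F \<and> F \<subseteq> quot_space M \<and> quot_independent M F}"

lemma coset_eq_subspace_iff:
  assumes "complex_vector.subspace M"
  shows "x +o M = M \<longleftrightarrow> x \<in> M"
proof
  assume "x +o M = M"
  then show "x \<in> M"
    using complex_vector.subspace_0[OF assms] by (force simp: elt_set_plus_def)
next
  assume x: "x \<in> M"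
  have "y \<in> x +o M" if "y \<in> M" for y
    using complex_vector.subspace_diff[OF assms that x]
    unfolding elt_set_plus_def by (auto intro!: bexI[of _ "y - x"])
  moreover have "y \<in> M" if "y \<in> x +o M" for y
    using that x complex_vector.subspace_add[OF assms] by (auto simp: elt_set_plus_def)
  ultimately show "x +o M = M"
    by blast
qed

lemma quot_scale_coset:
  assumes "complex_vector.subspace M"
  shows "quot_scale M a (x +o M) = (a *\<^sub>C x) +o M"
proof (intro set_eqI iffI)
  fix y
  assume "y \<in> quot_scale M a (x +o M)"
  then obtain m n where "m \<in> M" "n \<in> M" "y = a *\<^sub>C (x + m) + n"
    by (auto simp: quot_scale_def set_plus_def elt_set_plus_def)
  then have "y = a *\<^sub>C x + (a *\<^sub>C m + n)" "a *\<^sub>C m + n \<in> M"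
    using complex_vector.subspace_add[OF assms] complex_vector.subspace_scale[OF assms]
    by (auto simp: scaleC_add_right)
  then show "y \<in> (a *\<^sub>C x) +o M"
    by (auto simp: elt_set_plus_def)
next
  fix y
  assume "y \<in> (a *\<^sub>C x) +o M"
  then obtain m where "m \<in> M" "y = a *\<^sub>C x + m"
    by (auto simp: elt_set_plus_def)
  moreover have "x \<in> x +o M"
    using complex_vector.subspace_0[OF assms] by (force simp: elt_set_plus_def)
  ultimately show "y \<in> quot_scale M a (x +o M)"
    unfolding quot_scale_def by (blast intro: set_plus_intro)
qed

lemma quot_independent_iff:
  assumes M: "complex_vector.subspace M" and B: "finite B" and inj: "inj_on (\<lambda>x. x +o M) B"
  shows "quot_independent M ((\<lambda>x. x +o M) ` B) \<longleftrightarrow>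
    (\<forall>u. (\<Sum>b\<in>B. u b *\<^sub>C b) \<in> M \<longrightarrow> (\<forall>b\<in>B. u b = 0))"
proof -
  have coset_add: "(x +o M) + (y +o M) = (x + y) +o M" for x y
  proof -
    have "M + M = M"
      using complex_vector.subspace_0[OF M] complex_vector.subspace_add[OF M]
      by (force simp: set_plus_def)
    then show ?thesis
      by (simp add: set_plus_rearrange)
  qed
  have zero: "0 +o M = M"
    using coset_eq_subspace_iff[OF M] complex_vector.subspace_0[OF M] by blast
  have sum: "(\<Sum>b\<in>B'. (v b *\<^sub>C b) +o M) + M = (\<Sum>b\<in>B'. v b *\<^sub>C b) +o M"
    if "finite B'" for B' v
    using that
  proof (induction rule: finite_induct)
    case empty
    then show ?case using zero by simp
  next
    case (insert b B')
    then show ?case by (simp add: add.assoc coset_add)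
  qed
  have eq: "(\<Sum>K\<in>(\<lambda>x. x +o M) ` B. quot_scale M (u K) K) + M = M \<longleftrightarrow>
      (\<Sum>b\<in>B. u (b +o M) *\<^sub>C b) \<in> M" for u
    using B by (simp add: sum.reindex[OF inj] quot_scale_coset[OF M] sum coset_eq_subspace_iff[OF M])
  show ?thesis
  proof
    assume L: "quot_independent M ((\<lambda>x. x +o M) ` B)"
    show "\<forall>u. (\<Sum>b\<in>B. u b *\<^sub>C b) \<in> M \<longrightarrow> (\<forall>b\<in>B. u b = 0)"
    proof (intro allI impI)
      fix u
      assume u: "(\<Sum>b\<in>B. u b *\<^sub>C b) \<in> M"
      define w where "w K = u (the_inv_into B (\<lambda>x. x +o M) K)" for K
      have w: "w (b +o M) = u b" if "b \<in> B" for b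
        using the_inv_into_f_f[OF inj that] by (simp add: w_def)
      have "(\<Sum>b\<in>B. w (b +o M) *\<^sub>C b) \<in> M"
        using u w by (simp cong: sum.cong)
      then have "\<forall>b\<in>B. w (b +o M) = 0"
        using L unfolding quot_independent_def eq by blast
      then show "\<forall>b\<in>B. u b = 0"
        by (simp add: w)
    qed
  next
    assume R: "\<forall>u. (\<Sum>b\<in>B. u b *\<^sub>C b) \<in> M \<longrightarrow> (\<forall>b\<in>B. u b = 0)"
    show "quot_independent M ((\<lambda>x. x +o M) ` B)"
      unfolding quot_independent_def eq
    proof (intro allI impI)
      fix u :: "'a set \<Rightarrow> complex"
      assume "(\<Sum>b\<in>B. u (b +o M) *\<^sub>C b) \<in> M"
      with R[rule_format, of "\<lambda>b. u (b +o M)"]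
      show "\<forall>K\<in>(\<lambda>x. x +o M) ` B. u K = 0"
        by simp
    qed
  qed
qed

definition kernel :: "('a \<Rightarrow> 'b::zero) \<Rightarrow> 'a set"
  where "kernel T = {x. T x = 0}"

definition nullity :: "('a::complex_normed_vector \<Rightarrow> 'b::complex_normed_vector) \<Rightarrow> enat"
  where "nullity T = cdim (kernel T)"

definition deficiency :: "('a \<Rightarrow> 'b::complex_normed_vector) \<Rightarrow> enat"
  where "deficiency T = quot_dim (range T)"

text \<open>Only used for operators of finite deficiency, where the difference is well defined
  (possibly \<open>\<infinity>\<close>).\<close>

definition index :: "('a::complex_normed_vector \<Rightarrow> 'b::complex_normed_vector) \<Rightarrow> ereal"
  where "index T = ereal_of_enat (nullity T) - ereal_of_enat (deficiency T)"

section \<open>Semi-Weyl spectra\<close>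

definition closed_complemented :: "'a::complex_normed_vector set \<Rightarrow> bool"
  where "closed_complemented N \<longleftrightarrow> closed N \<and>
    (\<exists>W. complex_vector.subspace W \<and> closed W \<and> N \<inter> W = {0} \<and> N + W = UNIV)"

definition Phi_minus :: "('a::complex_banach \<Rightarrow> 'a) set"
  where "Phi_minus = {T. bounded_clinear T \<and> deficiency T < \<infinity>}"

definition Phi_r :: "('a::complex_banach \<Rightarrow> 'a) set"
  where "Phi_r = {T. bounded_clinear T \<and> closed_complemented (kernel T) \<and> deficiency T < \<infinity>}"

definition Phi_minus_plus :: "('a::complex_banach \<Rightarrow> 'a) set"
  where "Phi_minus_plus = {T \<in> Phi_minus. index T \<ge> 0}"

definition Phi_rw :: "('a::complex_banach \<Rightarrow> 'a) set"
  where "Phi_rw = {T \<in> Phi_r. index T \<ge> 0}"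

definition sigma_sw :: "('a::complex_banach \<Rightarrow> 'a) \<Rightarrow> complex set"
  where "sigma_sw T = {l. (\<lambda>x. T x - l *\<^sub>C x) \<notin> Phi_minus_plus}"

definition sigma_rw :: "('a::complex_banach \<Rightarrow> 'a) \<Rightarrow> complex set"
  where "sigma_rw T = {l. (\<lambda>x. T x - l *\<^sub>C x) \<notin> Phi_rw}"

section \<open>Single valued extension property\<close>

text \<open>As in the library's \<open>holomorphic_on\<close>: complex differentiability at every point. It is
  applied to open sets only.\<close>

definition vector_analytic_on :: "(complex \<Rightarrow> 'a::complex_banach) \<Rightarrow> complex set \<Rightarrow> bool"
  where "vector_analytic_on f V \<longleftrightarrow>
    (\<forall>z\<in>V. \<exists>d. (f has_derivative (\<lambda>h. h *\<^sub>C d)) (at z within V))"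

definition SVEP_at :: "('a::complex_banach \<Rightarrow> 'a) \<Rightarrow> complex \<Rightarrow> bool"
  where "SVEP_at T l \<longleftrightarrow> (\<exists>r>0. \<forall>V. open V \<and> V \<subseteq> ball l r \<longrightarrow>
    (\<forall>f. vector_analytic_on f V \<and> (\<forall>m\<in>V. T (f m) - m *\<^sub>C f m = 0) \<longrightarrow> (\<forall>m\<in>V. f m = 0)))"

definition SVEP_fail :: "('a::complex_banach \<Rightarrow> 'a) \<Rightarrow> complex set"
  where "SVEP_fail T = {l. \<not> SVEP_at T l}"

section \<open>Upper triangular operator matrices\<close>

definition upper_op ::
    "('a::complex_banach \<Rightarrow> 'a) \<Rightarrow> ('b::complex_banach \<Rightarrow> 'a) \<Rightarrow> ('b \<Rightarrow> 'b) \<Rightarrow> 'a \<times> 'b \<Rightarrow> 'a \<times> 'b"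
  where "upper_op A C B = (\<lambda>(x, y). (A x + C y, B y))"

end

theory Submission
  imports Defs
begin

text \<open>
  After subtracting \<open>\<lambda> I\<close> from all operators it suffices to treat \<open>\<lambda> = 0\<close>, assuming that \<open>B\<close> has the
  SVEP at \<open>0\<close> and that \<open>A\<close> or \<open>B\<^sup>*\<close> has it. Write \<open>\<alpha>\<close> for nullity, \<open>\<beta>\<close> for deficiency and \<open>M\<close> for
  the triangular operator.

  \<^item> Linear algebra. The snake lemma gives the exact sequence
    \<open>0 \<rightarrow> N(A) \<rightarrow> N(M) \<rightarrow> N(B) \<rightarrow> X/R(A) \<rightarrow> (X \<oplus> Y)/R(M) \<rightarrow> Y/R(B) \<rightarrow> 0\<close>. Counting dimensions along it
    (\<open>upper_op_dimensions\<close>) shows that \<open>ind M = ind A + ind B\<close> whenever this makes sense, that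
    \<open>\<beta>(B) \<le> \<beta>(M)\<close>, and that \<open>\<beta>(A)\<close> is finite once \<open>\<beta>(M)\<close> and \<open>\<alpha>(B)\<close> are.

  \<^item> Local spectral theory. If \<open>\<beta>(T) < \<infinity>\<close> and \<open>T\<close> has the SVEP at \<open>0\<close>, then \<open>\<alpha>(T) \<le> \<beta>(T)\<close>
    (\<open>SVEP_nullity_le_deficiency\<close>). For suppose that \<open>R(T) + W\<close> is the whole space with \<open>dim W\<close> finite.
    By the open mapping theorem every \<open>z \<in> N(T)\<close> is the value at \<open>0\<close> of an analytic \<open>g\<^sub>z\<close> with
    \<open>(T - \<mu>) g\<^sub>z(\<mu>) \<in> W\<close>. If \<open>N(T)\<close> contains more independent \<open>z\<close> than \<open>dim W\<close>, then elimination
    with analytic coefficients produces a nontrivial combination \<open>G\<close> of the \<open>g\<^sub>z\<close> with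
    \<open>(T - \<mu>) G(\<mu>) = 0\<close> on some small open set.

  \<^item> Duality. If \<open>B\<close> is Fredholm, then \<open>\<alpha>(B\<^sup>*) \<ge> \<beta>(B)\<close> and \<open>\<beta>(B\<^sup>*) \<le> \<alpha>(B)\<close>, so the same argument for
    \<open>B\<^sup>*\<close> shows that \<open>\<beta>(B) \<le> \<alpha>(B)\<close> if \<open>B\<^sup>*\<close> has the SVEP at \<open>0\<close> (\<open>dual_SVEP_deficiency_le_nullity\<close>).

  Now let \<open>M\<close> be lower semi-Weyl. Then \<open>\<beta>(B) < \<infinity>\<close>, so \<open>\<alpha>(B) \<le> \<beta>(B) < \<infinity>\<close> and \<open>\<beta>(A) < \<infinity>\<close>. From
  \<open>ind M \<ge> 0\<close> and \<open>ind B \<le> 0\<close> we get \<open>ind A \<ge> 0\<close>. If \<open>A\<close> has the SVEP then \<open>ind A \<le> 0\<close> and therefore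
  \<open>ind B \<ge> 0\<close>; if \<open>B\<^sup>*\<close> has it, then \<open>ind B \<ge> 0\<close> directly. The converse is additivity of the index.
  For the right semi-Weyl spectrum, \<open>N(A) \<oplus> 0\<close> has finite codimension in \<open>N(M)\<close> because
  \<open>\<alpha>(B) < \<infinity>\<close>, and complementedness passes between a closed subspace and a closed finite-dimensional
  extension of it; \<open>N(B)\<close> is complemented because it is finite-dimensional. Both facts rest on
  the Hahn-Banach theorem.
\<close>

section \<open>Complex subspaces and bounded operators\<close>

abbreviation csubspace :: "'a::complex_normed_vector set \<Rightarrow> bool"
  where "csubspace \<equiv> complex_vector.subspace"

abbreviation cspan :: "'a::complex_normed_vector set \<Rightarrow> 'a set"
  where "cspan \<equiv> complex_vector.span"

lemma bounded_clinear_bounded_linear: "bounded_clinear f \<Longrightarrow> bounded_linear f"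
  by (simp add: bounded_clinear_def)

lemma bounded_clinear_simps:
  assumes "bounded_clinear f"
  shows "f (x + y) = f x + f y" "f (x - y) = f x - f y" "f (- x) = - f x" "f 0 = 0"
    "f (c *\<^sub>C x) = c *\<^sub>C f x" "f (sum g F) = (\<Sum>i\<in>F. f (g i))"
proof -
  interpret bounded_linear f using assms by (simp add: bounded_clinear_def)
  show "f (x + y) = f x + f y" "f (x - y) = f x - f y" "f (- x) = - f x" "f 0 = 0"
    by (rule add diff neg zero)+
  show "f (c *\<^sub>C x) = c *\<^sub>C f x" using assms by (simp add: bounded_clinear_def)
  show "f (sum g F) = (\<Sum>i\<in>F. f (g i))" by (rule sum)
qed

lemma csubspace_kernel: "bounded_clinear T \<Longrightarrow> csubspace (kernel T)"
  by (simp add: complex_vector.subspace_def kernel_def bounded_clinear_simps)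

lemma csubspace_vimage: "bounded_clinear f \<Longrightarrow> csubspace M \<Longrightarrow> csubspace (f -` M)"
  by (simp add: complex_vector.subspace_def bounded_clinear_simps)

lemma csubspace_image:
  assumes "bounded_clinear f" "csubspace M" shows "csubspace (f ` M)"
  unfolding complex_vector.subspace_def
proof (intro conjI ballI allI)
  show "0 \<in> f ` M"
    by (rule image_eqI[of _ _ 0])
      (use complex_vector.subspace_0[OF assms(2)] bounded_clinear_simps(4)[OF assms(1)] in auto)
  fix x y c assume "x \<in> f ` M" "y \<in> f ` M"
  then obtain a b where ab: "a \<in> M" "b \<in> M" "x = f a" "y = f b" by auto
  show "x + y \<in> f ` M"
    by (rule image_eqI[of _ _ "a + b"])
      (use ab complex_vector.subspace_add[OF assms(2)] in \<open>auto simp: bounded_clinear_simps[OF assms(1)]\<close>)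
  show "c *\<^sub>C x \<in> f ` M"
    by (rule image_eqI[of _ _ "c *\<^sub>C a"])
      (use ab complex_vector.subspace_scale[OF assms(2)] in \<open>auto simp: bounded_clinear_simps[OF assms(1)]\<close>)
qed

lemma csubspace_range: "bounded_clinear f \<Longrightarrow> csubspace (range f)"
  by (rule csubspace_image) simp_all

section \<open>Dimension relative to a subspace\<close>

text \<open>Linear independence of the cosets of the elements of \<open>F\<close>. The condition also makes these
  cosets pairwise distinct, so that a set of cosets can be traded for a set of vectors.\<close>

definition indep_mod :: "'a::complex_normed_vector set \<Rightarrow> 'a set \<Rightarrow> bool"
  where "indep_mod M F \<longleftrightarrow> finite F \<and> (\<forall>u. (\<Sum>b\<in>F. u b *\<^sub>C b) \<in> M \<longrightarrow> (\<forall>b\<in>F. u b = 0))"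

text \<open>For subspaces this is \<open>dim (U + M)/M\<close>. Kernel dimensions (\<open>M = {0}\<close>) and codimensions of ranges
  (\<open>U = UNIV\<close>) are both instances, so that one additivity law covers the whole dimension count.\<close>

definition rel_dim :: "'a::complex_normed_vector set \<Rightarrow> 'a set \<Rightarrow> enat"
  where "rel_dim M U = Sup {enat (card F) |F. F \<subseteq> U \<and> indep_mod M F}"

lemma indep_mod_subset:
  assumes "indep_mod M F" "G \<subseteq> F" shows "indep_mod M G"
  unfolding indep_mod_def
proof (intro conjI allI impI)
  have fin: "finite F" using assms by (simp add: indep_mod_def)
  then show "finite G" using assms(2) finite_subset by blast
  fix u assume u: "(\<Sum>b\<in>G. u b *\<^sub>C b) \<in> M"
  define v where "v b = (if b \<in> G then u b else 0)" for b
  have "(\<Sum>b\<in>F. v b *\<^sub>C b) = (\<Sum>b\<in>G. u b *\<^sub>C b)"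
    using assms(2) fin by (intro sum.mono_neutral_cong_right) (auto simp: v_def)
  then have "\<forall>b\<in>F. v b = 0" using assms(1) u by (simp add: indep_mod_def)
  then show "\<forall>b\<in>G. u b = 0" using assms(2) by (auto simp: v_def split: if_splits)
qed

text \<open>A subset of an independent set is independent, hence every size below the supremum is attained.\<close>

lemma enat_le_rel_dim_iff:
  "enat n \<le> rel_dim M U \<longleftrightarrow> (\<exists>F\<subseteq>U. indep_mod M F \<and> card F = n)"
proof
  assume n: "enat n \<le> rel_dim M U"
  have "\<exists>G\<subseteq>U. indep_mod M G \<and> n \<le> card G"
  proof (rule ccontr)
    assume neg: "\<not> ?thesis"
    have "n \<noteq> 0"
    proof
      assume "n = 0"
      then have "{} \<subseteq> U" "indep_mod M {}" "n \<le> card {}" by (simp_all add: indep_mod_def)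
      with neg show False by blast
    qed
    moreover have "rel_dim M U \<le> enat (n - 1)"
      unfolding rel_dim_def using neg by (intro Sup_least) force
    ultimately show False
      using order_trans[OF n, of "enat (n - 1)"] by simp
  qed
  then obtain G where G: "G \<subseteq> U" "indep_mod M G" "n \<le> card G" by blast
  then obtain F where "F \<subseteq> G" "card F = n" using obtain_subset_with_card_n by metis
  then show "\<exists>F\<subseteq>U. indep_mod M F \<and> card F = n"
    using G indep_mod_subset by blast
next
  assume "\<exists>F\<subseteq>U. indep_mod M F \<and> card F = n"
  then show "enat n \<le> rel_dim M U"
    unfolding rel_dim_def by (intro Sup_upper) auto
qed

lemma enat_le_iff_enat_below: "a \<le> b \<longleftrightarrow> (\<forall>n. enat n \<le> a \<longrightarrow> enat n \<le> b)"
proof (cases a; cases b)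
  fix m assume *: "a = \<infinity>" "b = enat m"
  then have "\<not> enat (Suc m) \<le> b" by simp
  moreover have "enat (Suc m) \<le> a" using * by simp
  moreover have "\<not> a \<le> b" using * by simp
  ultimately show ?thesis by blast
qed (auto intro: order_trans)

lemma rel_dim_mono: "U \<subseteq> V \<Longrightarrow> rel_dim M U \<le> rel_dim M V"
  unfolding rel_dim_def by (intro Sup_subset_mono) auto

lemma sum_scaleC_delta:
  fixes F :: "'a::complex_normed_vector set"
  assumes "finite F" "f \<in> F"
  shows "(\<Sum>b\<in>F. (if b = f then 1 else 0) *\<^sub>C b) = f"
proof -
  have "(\<Sum>b\<in>F. (if b = f then 1 else 0) *\<^sub>C b) = (\<Sum>b\<in>F. if b = f then b else 0)"
    by (intro sum.cong) (auto simp: scaleC_one)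
  then show ?thesis using assms by simp
qed

lemma indep_mod_notin:
  assumes "indep_mod M F" "f \<in> F"
  shows "f \<notin> M"
proof
  assume "f \<in> M"
  moreover have "finite F" using assms(1) by (simp add: indep_mod_def)
  ultimately have "(\<Sum>b\<in>F. (if b = f then 1 else 0) *\<^sub>C b) \<in> M"
    using sum_scaleC_delta assms(2) by metis
  then show False using assms unfolding indep_mod_def by fastforce
qed

lemma indep_mod_diff_notin:
  assumes "indep_mod M F" "x \<in> F" "y \<in> F" "x \<noteq> y"
  shows "x - y \<notin> M"
proof
  have fin: "finite F" using assms(1) by (simp add: indep_mod_def)
  define u where "u b = (if b = x then 1 else if b = y then -1 else 0 :: complex)" for b
  have "(\<Sum>b\<in>F. u b *\<^sub>C b) = (\<Sum>b\<in>{x,y}. u b *\<^sub>C b)"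
    using assms fin by (intro sum.mono_neutral_right) (auto simp: u_def)
  also have "\<dots> = x - y"
    using assms(4) by (simp add: u_def scaleC_one complex_vector.scale_minus_left)
  finally have eq: "(\<Sum>b\<in>F. u b *\<^sub>C b) = x - y" .
  assume "x - y \<in> M"
  then have "u x = 0" using eq assms(1,2) unfolding indep_mod_def by metis
  then show False by (simp add: u_def)
qed

text \<open>The Steinitz exchange lemma modulo \<open>L\<close>. An element of \<open>F\<close> that involves \<open>g\<close> can take the place
  of \<open>g\<close> among the generators; it is then absorbed into \<open>L\<close>, which is why \<open>L\<close> varies in the induction.\<close>

lemma indep_mod_exchange:
  assumes "finite G" "indep_mod (cspan L) F" "F \<subseteq> cspan (L \<union> G)"
  shows "card F \<le> card G"
  using assms
proof (induction G arbitrary: L F rule: finite_induct)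
  case empty
  have "F = {}"
  proof (rule ccontr)
    assume "F \<noteq> {}"
    then obtain f where f: "f \<in> F" by blast
    then show False using empty indep_mod_notin by (metis sup_bot_right subsetD)
  qed
  then show ?case by simp
next
  case (insert g G)
  have fin: "finite F" using insert.prems by (simp add: indep_mod_def)
  show ?case
  proof (cases "F \<subseteq> cspan (L \<union> G)")
    case True
    then show ?thesis using insert.IH[OF insert.prems(1)] insert.hyps by simp
  next
    case False
    then obtain f where f: "f \<in> F" "f \<notin> cspan (L \<union> G)" by blast
    have "f \<in> cspan (insert g (L \<union> G))" using f insert.prems by auto
    then have g: "g \<in> cspan (insert f L \<union> G)"
      using complex_vector.in_span_insert f(2) by force
    have "insert g (L \<union> G) \<subseteq> cspan (insert f L \<union> G)"
      using g by (auto intro: complex_vector.span_base)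
    then have "cspan (insert g (L \<union> G)) \<subseteq> cspan (insert f L \<union> G)"
      by (intro complex_vector.span_minimal) auto
    then have sub: "F - {f} \<subseteq> cspan (insert f L \<union> G)" using insert.prems by auto
    have "indep_mod (cspan (insert f L)) (F - {f})"
      unfolding indep_mod_def
    proof (intro conjI allI impI)
      show "finite (F - {f})" using fin by simp
      fix u assume "(\<Sum>b\<in>F - {f}. u b *\<^sub>C b) \<in> cspan (insert f L)"
      then obtain k where k: "(\<Sum>b\<in>F - {f}. u b *\<^sub>C b) - k *\<^sub>C f \<in> cspan L"
        unfolding complex_vector.span_breakdown_eq by blast
      define v where "v = u(f := - k)"
      have "(\<Sum>b\<in>F. v b *\<^sub>C b) = (\<Sum>b\<in>F - {f}. u b *\<^sub>C b) - k *\<^sub>C f"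
        using fin f(1) by (simp add: sum.remove v_def complex_vector.scale_minus_left)
      then have "\<forall>b\<in>F. v b = 0" using k insert.prems(1) by (simp add: indep_mod_def)
      then show "\<forall>b\<in>F - {f}. u b = 0" by (force simp: v_def split: if_splits)
    qed
    from insert.IH[OF this sub] show ?thesis using fin f insert.hyps
      by (simp add: card_Diff_singleton)
  qed
qed

lemma rel_dim_le_card:
  assumes "csubspace M" "finite G" "U \<subseteq> cspan (M \<union> G)"
  shows "rel_dim M U \<le> enat (card G)"
  unfolding rel_dim_def
proof (rule Sup_least, clarsimp)
  fix F assume F: "F \<subseteq> U" "indep_mod M F"
  have "cspan M = M" using assms(1) by (rule complex_vector.span_eq_iff[THEN iffD2])
  then show "card F \<le> card G"
    using indep_mod_exchange[of G M F] F assms by (metis subset_trans)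
qed

lemma indep_mod_insert:
  assumes "csubspace M" "indep_mod M F" "x \<notin> cspan (M \<union> F)"
  shows "indep_mod M (insert x F)"
  unfolding indep_mod_def
proof (intro conjI allI impI)
  have fin: "finite F" using assms by (simp add: indep_mod_def)
  then show "finite (insert x F)" by simp
  have x: "x \<notin> F" using assms(3) complex_vector.span_base[of x "M \<union> F"] by auto
  fix u assume "(\<Sum>b\<in>insert x F. u b *\<^sub>C b) \<in> M"
  then have *: "u x *\<^sub>C x + (\<Sum>b\<in>F. u b *\<^sub>C b) \<in> M" using fin x by simp
  have sF: "(\<Sum>b\<in>F. u b *\<^sub>C b) \<in> cspan (M \<union> F)"
    by (intro complex_vector.span_sum complex_vector.span_scale complex_vector.span_base) auto
  have "u x *\<^sub>C x \<in> cspan (M \<union> F)"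
    using complex_vector.span_diff[OF complex_vector.span_base[of _ "M \<union> F"] sF] * by fastforce
  then have "u x = 0"
    using assms(3) complex_vector.span_scale[of "u x *\<^sub>C x" "M \<union> F" "inverse (u x)"]
    by (cases "u x = 0"; simp)
  moreover from this have "\<forall>b\<in>F. u b = 0"
    using * assms(2) by (simp add: indep_mod_def)
  ultimately show "\<forall>b\<in>insert x F. u b = 0" by simp
qed

lemma rel_dim_finite_basis:
  assumes M: "csubspace M" and n: "rel_dim M U = enat n"
  obtains F where "F \<subseteq> U" "indep_mod M F" "card F = n" "U \<subseteq> cspan (M \<union> F)"
proof -
  obtain F where F: "F \<subseteq> U" "indep_mod M F" "card F = n"
    using enat_le_rel_dim_iff[of n M U] n by auto
  have "U \<subseteq> cspan (M \<union> F)"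
  proof (rule ccontr)
    assume "\<not> ?thesis"
    then obtain x where x: "x \<in> U" "x \<notin> cspan (M \<union> F)" by blast
    then have "x \<notin> F" using complex_vector.span_base[of x "M \<union> F"] by auto
    moreover have "finite F" using F by (simp add: indep_mod_def)
    ultimately have "card (insert x F) = Suc n" using F by simp
    then have "enat (Suc n) \<le> rel_dim M U"
      unfolding enat_le_rel_dim_iff using indep_mod_insert[OF M F(2) x(2)] F x by blast
    then show False using n by simp
  qed
  then show thesis using that F by blast
qed

text \<open>Additivity along \<open>L \<subseteq> M \<subseteq> U\<close>: a basis of \<open>M\<close> modulo \<open>L\<close> and one of \<open>U\<close> modulo \<open>M\<close> together
  form a basis of \<open>U\<close> modulo \<open>L\<close>.\<close>

lemma rel_dim_trans:
  assumes L: "csubspace L" and M: "csubspace M" and LM: "L \<subseteq> M" and MU: "M \<subseteq> U"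
  shows "rel_dim L U = rel_dim L M + rel_dim M U"
proof (rule antisym)
  show "rel_dim L U \<le> rel_dim L M + rel_dim M U"
  proof (cases "rel_dim L M"; cases "rel_dim M U")
    fix a b assume ab: "rel_dim L M = enat a" "rel_dim M U = enat b"
    obtain F where F: "F \<subseteq> M" "indep_mod L F" "card F = a" "M \<subseteq> cspan (L \<union> F)"
      using rel_dim_finite_basis[OF L ab(1)] .
    obtain G where G: "G \<subseteq> U" "indep_mod M G" "card G = b" "U \<subseteq> cspan (M \<union> G)"
      using rel_dim_finite_basis[OF M ab(2)] .
    have "M \<subseteq> cspan (L \<union> (F \<union> G))"
      using F(4) complex_vector.span_mono[of "L \<union> F" "L \<union> (F \<union> G)"] by blast
    then have "cspan (M \<union> G) \<subseteq> cspan (L \<union> (F \<union> G))"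
      by (intro complex_vector.span_minimal) (auto intro: complex_vector.span_base)
    then have "rel_dim L U \<le> enat (card (F \<union> G))"
      using F G by (intro rel_dim_le_card[OF L]) (auto simp: indep_mod_def)
    also have "\<dots> \<le> enat (a + b)" using F G card_Un_le[of F G] by simp
    finally show ?thesis using ab by simp
  qed auto
  have key: "enat (n + m) \<le> rel_dim L U"
    if n: "enat n \<le> rel_dim L M" and m: "enat m \<le> rel_dim M U" for n m
  proof -
    obtain F where F: "F \<subseteq> M" "indep_mod L F" "card F = n" using n enat_le_rel_dim_iff by metis
    obtain G where G: "G \<subseteq> U" "indep_mod M G" "card G = m" using m enat_le_rel_dim_iff by metis
    have fin: "finite F" "finite G" using F G by (auto simp: indep_mod_def)
    have sF: "(\<Sum>b\<in>F. u b *\<^sub>C b) \<in> M" for u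
      using F M by (intro complex_vector.subspace_sum complex_vector.subspace_scale) auto
    have "F \<inter> G = {}" using F(1) indep_mod_notin[OF G(2)] by blast
    then have "card (F \<union> G) = n + m" using F G fin by (simp add: card_Un_disjoint)
    moreover have "indep_mod L (F \<union> G)"
      unfolding indep_mod_def
    proof (intro conjI allI impI)
      show "finite (F \<union> G)" using fin by simp
      fix u assume "(\<Sum>b\<in>F \<union> G. u b *\<^sub>C b) \<in> L"
      then have *: "(\<Sum>b\<in>F. u b *\<^sub>C b) + (\<Sum>b\<in>G. u b *\<^sub>C b) \<in> L"
        using fin \<open>F \<inter> G = {}\<close> by (simp add: sum.union_disjoint)
      then have "(\<Sum>b\<in>G. u b *\<^sub>C b) \<in> M"
        using complex_vector.subspace_diff[OF M _ sF[of u]] LM by fastforce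
      then have G0: "\<forall>b\<in>G. u b = 0" using G by (simp add: indep_mod_def)
      then have "(\<Sum>b\<in>F. u b *\<^sub>C b) \<in> L" using * by simp
      then show "\<forall>b\<in>F \<union> G. u b = 0" using G0 F by (auto simp: indep_mod_def)
    qed
    ultimately show ?thesis
      unfolding enat_le_rel_dim_iff using F G MU by blast
  qed
  show "rel_dim L M + rel_dim M U \<le> rel_dim L U"
  proof (cases "rel_dim L M")
    case (enat a)
    show ?thesis
    proof (cases "rel_dim M U")
      case (enat b)
      then show ?thesis using key[of a b] \<open>rel_dim L M = enat a\<close> by simp
    next
      case infinity
      have "enat m \<le> rel_dim L U" for m
        using key[of 0 m] infinity by (simp add: zero_enat_def[symmetric])
      then show ?thesis using enat_le_iff_enat_below by blast
    qed
  next
    case infinity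
    have "enat m \<le> rel_dim L U" for m
      using key[of m 0] infinity by (simp add: zero_enat_def[symmetric])
    then show ?thesis using enat_le_iff_enat_below by blast
  qed
qed

lemma indep_mod_image:
  assumes "bounded_clinear f" "inj_on f F"
  shows "indep_mod M (f ` F) \<longleftrightarrow> indep_mod (f -` M) F"
proof -
  have eq: "(\<Sum>b\<in>f ` F. u b *\<^sub>C b) = f (\<Sum>b\<in>F. u (f b) *\<^sub>C b)" for u
    using assms by (simp add: sum.reindex bounded_clinear_simps)
  show ?thesis
  proof
    assume L: "indep_mod M (f ` F)"
    show "indep_mod (f -` M) F"
      unfolding indep_mod_def
    proof (intro conjI allI impI)
      show "finite F" using L assms(2) finite_imageD by (auto simp: indep_mod_def)
      fix u assume "(\<Sum>b\<in>F. u b *\<^sub>C b) \<in> f -` M"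
      moreover define v where "v y = u (the_inv_into F f y)" for y
      have v: "v (f b) = u b" if "b \<in> F" for b
        using the_inv_into_f_f[OF assms(2) that] by (simp add: v_def)
      ultimately have "(\<Sum>b\<in>f ` F. v b *\<^sub>C b) \<in> M" by (simp add: eq cong: sum.cong)
      then show "\<forall>b\<in>F. u b = 0" using L v by (force simp: indep_mod_def)
    qed
  next
    assume R: "indep_mod (f -` M) F"
    show "indep_mod M (f ` F)"
      unfolding indep_mod_def eq
    proof (intro conjI allI impI)
      show "finite (f ` F)" using R by (simp add: indep_mod_def)
      fix u assume "f (\<Sum>b\<in>F. u (f b) *\<^sub>C b) \<in> M"
      then show "\<forall>b\<in>f ` F. u b = 0"
        using R unfolding indep_mod_def by (auto dest: spec[of _ "\<lambda>b. u (f b)"])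
    qed
  qed
qed

text \<open>For subspaces \<open>U\<close>, the homomorphism theorem \<open>U/(U \<inter> f\<^sup>-\<^sup>1 M) \<cong> f(U)/(f(U) \<inter> M)\<close>, on the level of dimensions.\<close>

lemma rel_dim_image:
  assumes f: "bounded_clinear f" and M: "csubspace M"
  shows "rel_dim M (f ` U) = rel_dim (f -` M) U"
proof -
  have "(\<exists>F\<subseteq>f ` U. indep_mod M F \<and> card F = n) \<longleftrightarrow>
      (\<exists>F\<subseteq>U. indep_mod (f -` M) F \<and> card F = n)" for n
  proof
    assume "\<exists>F\<subseteq>f ` U. indep_mod M F \<and> card F = n"
    then obtain F where F: "F \<subseteq> f ` U" "indep_mod M F" "card F = n" by blast
    then obtain G where G: "G \<subseteq> U" "inj_on f G" "F = f ` G" using subset_image_inj by metis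
    then show "\<exists>F\<subseteq>U. indep_mod (f -` M) F \<and> card F = n"
      using F indep_mod_image[OF f G(2)] card_image by metis
  next
    assume "\<exists>F\<subseteq>U. indep_mod (f -` M) F \<and> card F = n"
    then obtain F where F: "F \<subseteq> U" "indep_mod (f -` M) F" "card F = n" by blast
    have "inj_on f F"
    proof (rule inj_onI, rule ccontr)
      fix x y assume xy: "x \<in> F" "y \<in> F" "f x = f y" "x \<noteq> y"
      then have "x - y \<in> f -` M"
        using complex_vector.subspace_0[OF M] by (simp add: bounded_clinear_simps[OF f])
      then show False using indep_mod_diff_notin[OF F(2)] xy by blast
    qed
    then have "indep_mod M (f ` F)" "card (f ` F) = n"
      using indep_mod_image[OF f] F by (auto simp: card_image)
    then show "\<exists>F\<subseteq>f ` U. indep_mod M F \<and> card F = n" using F by blast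
  qed
  then have "enat n \<le> rel_dim M (f ` U) \<longleftrightarrow> enat n \<le> rel_dim (f -` M) U" for n
    by (simp add: enat_le_rel_dim_iff)
  then show ?thesis
    using enat_le_iff_enat_below by (metis antisym)
qed

lemma rel_dim_Int:
  assumes "csubspace U" shows "rel_dim (M \<inter> U) U = rel_dim M U"
proof -
  have "indep_mod (M \<inter> U) F \<longleftrightarrow> indep_mod M F" if "F \<subseteq> U" for F
  proof -
    have "(\<Sum>b\<in>F. u b *\<^sub>C b) \<in> U" for u
      using that assms by (intro complex_vector.subspace_sum complex_vector.subspace_scale) auto
    then show ?thesis by (simp add: indep_mod_def)
  qed
  then show ?thesis unfolding rel_dim_def by metis
qed

lemma rel_dim_span_Un:
  assumes "csubspace M" shows "rel_dim M (cspan (M \<union> U)) = rel_dim M U"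
proof (rule antisym)
  show "rel_dim M U \<le> rel_dim M (cspan (M \<union> U))"
    by (intro rel_dim_mono) (auto intro: complex_vector.span_base)
  show "rel_dim M (cspan (M \<union> U)) \<le> rel_dim M U"
  proof (cases "rel_dim M U")
    case (enat n)
    then obtain F where F: "indep_mod M F" "card F = n" "U \<subseteq> cspan (M \<union> F)"
      using rel_dim_finite_basis[OF assms] by metis
    have "cspan (M \<union> U) \<subseteq> cspan (M \<union> F)"
      using F by (intro complex_vector.span_minimal) (auto intro: complex_vector.span_base)
    then show ?thesis using rel_dim_le_card[OF assms, of F] F enat by (auto simp: indep_mod_def)
  qed simp
qed

lemma cdim_eq_rel_dim:
  assumes "csubspace V" shows "cdim V = rel_dim {0} V"
proof (cases "\<exists>B. finite B \<and> V \<subseteq> cspan B")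
  case True
  then obtain B where B: "finite B" "V \<subseteq> cspan B" by blast
  obtain E where E: "E \<subseteq> V" "complex_vector.independent E" "V \<subseteq> cspan E"
      "card E = complex_vector.dim V"
    using complex_vector.basis_exists by blast
  have finE: "finite E"
    using complex_vector.independent_span_bound[OF B(1) E(2)] E B by auto
  have "indep_mod {0} E"
    using finE E(2) unfolding indep_mod_def complex_vector.dependent_finite[OF finE] by auto
  then have "enat (card E) \<le> rel_dim {0} V"
    unfolding enat_le_rel_dim_iff using E by blast
  moreover have "rel_dim {0} V \<le> enat (card E)"
    using finE E complex_vector.span_mono[of E "{0} \<union> E"]
    by (intro rel_dim_le_card) (auto simp: complex_vector.subspace_def)
  ultimately show ?thesis using True E by (simp add: cdim_def)
next
  case False
  have "rel_dim {0} V = \<infinity>"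
  proof (cases "rel_dim {0} V")
    case (enat n)
    then obtain F where "indep_mod {0} F" "V \<subseteq> cspan ({0} \<union> F)"
      using rel_dim_finite_basis[of "{0}" V n] by (auto simp: complex_vector.subspace_def)
    then show ?thesis using False by (auto simp: indep_mod_def)
  qed
  then show ?thesis using False by (simp only: cdim_def if_False)
qed

lemma quot_dim_eq_rel_dim:
  assumes M: "csubspace M" shows "quot_dim M = rel_dim M UNIV"
proof -
  have "(\<exists>F. n = enat (card F) \<and> finite F \<and> F \<subseteq> quot_space M \<and> quot_independent M F) \<longleftrightarrow>
    (\<exists>F. n = enat (card F) \<and> F \<subseteq> UNIV \<and> indep_mod M F)" for n
  proof
    assume "\<exists>F. n = enat (card F) \<and> finite F \<and> F \<subseteq> quot_space M \<and> quot_independent M F"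
    then obtain F where F: "n = enat (card F)" "finite F" "F \<subseteq> quot_space M" "quot_independent M F"
      by blast
    obtain B where B: "inj_on (\<lambda>x. x +o M) B" "F = (\<lambda>x. x +o M) ` B"
      using F(3) unfolding quot_space_def subset_image_inj by blast
    have "finite B" using B F(2) finite_imageD by blast
    then have "indep_mod M B"
      using quot_independent_iff[OF M _ B(1)] F(4) B(2) by (simp add: indep_mod_def)
    then show "\<exists>F. n = enat (card F) \<and> F \<subseteq> UNIV \<and> indep_mod M F"
      using F B by (auto simp: card_image)
  next
    assume "\<exists>F. n = enat (card F) \<and> F \<subseteq> UNIV \<and> indep_mod M F"
    then obtain F where F: "n = enat (card F)" "indep_mod M F" by blast
    have fin: "finite F" using F by (simp add: indep_mod_def)
    have inj: "inj_on (\<lambda>x. x +o M) F"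
    proof (rule inj_onI, rule ccontr)
      fix x y assume xy: "x \<in> F" "y \<in> F" "x +o M = y +o M" "x \<noteq> y"
      have "x \<in> x +o M"
        using complex_vector.subspace_0[OF M] by (force simp: elt_set_plus_def)
      then obtain m where m: "m \<in> M" "x = y + m"
        unfolding xy(3) by (auto simp: elt_set_plus_def)
      then have "x - y \<in> M" by simp
      then show False using indep_mod_diff_notin[OF F(2)] xy by blast
    qed
    have "quot_independent M ((\<lambda>x. x +o M) ` F)"
      using quot_independent_iff[OF M fin inj] F(2) by (simp add: indep_mod_def)
    then show "\<exists>F. n = enat (card F) \<and> finite F \<and> F \<subseteq> quot_space M \<and> quot_independent M F"
      using fin F inj
      by (intro exI[of _ "(\<lambda>x. x +o M) ` F"]) (auto simp: card_image quot_space_def)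
  qed
  then show ?thesis unfolding quot_dim_def rel_dim_def by simp
qed

section \<open>The Hahn-Banach theorem\<close>

definition sublinear :: "('a::real_vector \<Rightarrow> real) \<Rightarrow> bool"
  where "sublinear p \<longleftrightarrow> (\<forall>x y. p (x + y) \<le> p x + p y) \<and> (\<forall>t>0. \<forall>x. p (t *\<^sub>R x) = t * p x)"

lemma sublinear_add: "sublinear p \<Longrightarrow> p (x + y) \<le> p x + p y"
  and sublinear_scale: "sublinear p \<Longrightarrow> t > 0 \<Longrightarrow> p (t *\<^sub>R x) = t * p x"
  by (simp_all add: sublinear_def)

lemma sublinear_zero: "sublinear p \<Longrightarrow> p 0 = 0"
  using sublinear_scale[of p 2 0] by simp

lemma sublinear_lower: "sublinear p \<Longrightarrow> - p (- x) \<le> p x"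
  using sublinear_add[of p x "- x"] sublinear_zero[of p] by simp

lemma sublinearI:
  assumes "\<And>x y. p (x + y) \<le> p x + p y" "\<And>t x. t > 0 \<Longrightarrow> p (t *\<^sub>R x) \<le> t * p x"
  shows "sublinear p"
  unfolding sublinear_def
proof (intro conjI allI impI antisym)
  fix t :: real and x assume t: "t > 0"
  show "p (t *\<^sub>R x) \<le> t * p x" using assms(2) t .
  have "p ((1 / t) *\<^sub>R (t *\<^sub>R x)) \<le> (1 / t) * p (t *\<^sub>R x)" using t by (intro assms(2)) simp
  then have "p x \<le> p (t *\<^sub>R x) / t" using t by simp
  then show "t * p x \<le> p (t *\<^sub>R x)" using t by (simp add: pos_le_divide_eq mult.commute)
qed (use assms in auto)

text \<open>Making a sublinear functional smaller so that it becomes affine in the direction \<open>x\<close>. A minimal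
  sublinear functional is left unchanged for every \<open>x\<close>, which forces it to be odd and hence linear;
  applied once at the start, the same reduction prescribes the value at \<open>x\<close>.\<close>

lemma sublinear_reduce:
  assumes p: "sublinear p"
  obtains r where "sublinear r" "r \<le> p" "r (- x) \<le> - p x"
proof -
  \<comment> \<open>The largest sublinear minorant of \<open>p\<close> with \<open>r (- x) \<le> - p x\<close>.\<close>
  define r where "r y = (INF t\<in>{0..}. p (y + t *\<^sub>R x) - t * p x)" for y
  have low: "- p (- y) \<le> p (y + t *\<^sub>R x) - t * p x" if "t \<ge> 0" for y t
  proof (cases "t = 0")
    case True
    then show ?thesis using sublinear_lower[OF p, of y] by simp
  next
    case False
    then have "t * p x = p (t *\<^sub>R x)" using that sublinear_scale[OF p] by simp
    also have "\<dots> \<le> p (y + t *\<^sub>R x) + p (- y)"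
      using sublinear_add[OF p, of "y + t *\<^sub>R x" "- y"] by simp
    finally show ?thesis by simp
  qed
  then have bdd: "bdd_below ((\<lambda>t. p (y + t *\<^sub>R x) - t * p x) ` {0..})" for y
    by (intro bdd_belowI2) auto
  have le: "r y \<le> p (y + t *\<^sub>R x) - t * p x" if "t \<ge> 0" for y t
    unfolding r_def using that by (intro cINF_lower bdd) auto
  have ge: "c \<le> r y" if "\<And>t. t \<ge> 0 \<Longrightarrow> c \<le> p (y + t *\<^sub>R x) - t * p x" for c y
    unfolding r_def using that by (intro cINF_greatest) auto
  have "sublinear r"
  proof (rule sublinearI)
    fix y z
    have "r (y + z) \<le> (p (y + s *\<^sub>R x) - s * p x) + (p (z + t *\<^sub>R x) - t * p x)"
      if "s \<ge> 0" "t \<ge> 0" for s t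
    proof -
      have "r (y + z) \<le> p ((y + z) + (s + t) *\<^sub>R x) - (s + t) * p x" using le that by simp
      moreover have "p ((y + z) + (s + t) *\<^sub>R x) \<le> p (y + s *\<^sub>R x) + p (z + t *\<^sub>R x)"
        using sublinear_add[OF p, of "y + s *\<^sub>R x" "z + t *\<^sub>R x"] by (simp add: algebra_simps)
      ultimately show ?thesis by (simp add: algebra_simps)
    qed
    then have "r (y + z) - (p (z + t *\<^sub>R x) - t * p x) \<le> r y" if "t \<ge> 0" for t
      using that by (intro ge) (simp add: algebra_simps)
    then have "r (y + z) - r y \<le> r z"
      by (intro ge) (simp add: algebra_simps)
    then show "r (y + z) \<le> r y + r z" by simp
  next
    fix c :: real and y assume c: "c > 0"
    have "r (c *\<^sub>R y) / c \<le> r y"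
    proof (rule ge)
      fix t :: real assume "t \<ge> 0"
      then have "r (c *\<^sub>R y) \<le> p (c *\<^sub>R y + (c * t) *\<^sub>R x) - (c * t) * p x" using le c by simp
      also have "c *\<^sub>R y + (c * t) *\<^sub>R x = c *\<^sub>R (y + t *\<^sub>R x)" by (simp add: algebra_simps)
      also have "p (c *\<^sub>R (y + t *\<^sub>R x)) = c * p (y + t *\<^sub>R x)" by (rule sublinear_scale[OF p c])
      finally have "r (c *\<^sub>R y) \<le> (p (y + t *\<^sub>R x) - t * p x) * c" by (simp add: algebra_simps)
      then show "r (c *\<^sub>R y) / c \<le> p (y + t *\<^sub>R x) - t * p x" using c by (simp add: pos_divide_le_eq)
    qed
    then show "r (c *\<^sub>R y) \<le> c * r y" using c by (simp add: field_simps)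
  qed
  moreover have "r \<le> p" using le[of 0] by (simp add: le_fun_def)
  moreover have "r (- x) \<le> - p x" using le[of 1 "- x"] sublinear_zero[OF p] by simp
  ultimately show thesis using that by blast
qed

text \<open>Zorn's lemma for the pointwise order. The infimum of a chain is finite because
  every \<open>q \<le> p\<close> satisfies \<open>q x \<ge> - q (- x) \<ge> - p (- x)\<close>, and subadditive because any two members of the
  chain have a common lower bound in it.\<close>

lemma minimal_sublinear_exists:
  assumes p: "sublinear p"
  obtains q where "sublinear q" "q \<le> p" "\<And>r. sublinear r \<Longrightarrow> r \<le> q \<Longrightarrow> r = q"
proof -
  define A where "A = {q. sublinear q \<and> q \<le> p}"
  have "\<exists>m\<in>A. \<forall>a\<in>A. m \<ge> a \<longrightarrow> a = m"
  proof (rule predicate_Zorn)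
    show "partial_order_on A (relation_of (\<ge>) A)"
      by (rule partial_order_on_relation_ofI) auto
    fix C assume C: "C \<in> Chains (relation_of (\<ge>) A)"
    then have CA: "C \<subseteq> A" and tot: "\<And>q r. q \<in> C \<Longrightarrow> r \<in> C \<Longrightarrow> q \<le> r \<or> r \<le> q"
      unfolding Chains_def relation_of_def by auto
    show "\<exists>u\<in>A. \<forall>a\<in>C. a \<ge> u"
    proof (cases "C = {}")
      case True
      then show ?thesis using p by (auto simp: A_def)
    next
      case False
      define u where "u x = (INF q\<in>C. q x)" for x
      have bdd: "bdd_below ((\<lambda>q. q x) ` C)" for x
      proof (rule bdd_belowI2)
        fix q assume "q \<in> C"
        then have q: "sublinear q" "q \<le> p" using CA by (auto simp: A_def)
        show "- p (- x) \<le> q x"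
          using sublinear_lower[OF q(1), of x] le_funD[OF q(2), of "- x"] by linarith
      qed
      have le: "u x \<le> q x" if "q \<in> C" for q x
        unfolding u_def using that by (intro cINF_lower bdd)
      have ge: "c \<le> u x" if "\<And>q. q \<in> C \<Longrightarrow> c \<le> q x" for c x
        unfolding u_def using that False by (intro cINF_greatest) auto
      have "sublinear u"
      proof (rule sublinearI)
        fix x y
        have "u (x + y) \<le> q x + r y" if qr: "q \<in> C" "r \<in> C" for q r
        proof -
          obtain s where s: "s \<in> C" "s \<le> q" "s \<le> r" using tot[OF qr] qr by blast
          then have "s (x + y) \<le> s x + s y" using CA sublinear_add by (auto simp: A_def)
          then show ?thesis
            using le[OF s(1), of "x + y"] le_funD[OF s(2), of x] le_funD[OF s(3), of y] by linarith
        qed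
        then have "u (x + y) - r y \<le> u x" if "r \<in> C" for r
          using that by (intro ge) (simp add: algebra_simps)
        then have "u (x + y) - u x \<le> u y"
          by (intro ge) (simp add: algebra_simps)
        then show "u (x + y) \<le> u x + u y" by simp
      next
        fix t :: real and x assume t: "t > 0"
        have "u (t *\<^sub>R x) / t \<le> u x"
        proof (rule ge)
          fix q assume q: "q \<in> C"
          then have "q (t *\<^sub>R x) = t * q x" using CA t sublinear_scale by (auto simp: A_def)
          then show "u (t *\<^sub>R x) / t \<le> q x" using le[OF q, of "t *\<^sub>R x"] t by (simp add: field_simps)
        qed
        then show "u (t *\<^sub>R x) \<le> t * u x" using t by (simp add: field_simps)
      qed
      moreover have "u \<le> q" if "q \<in> C" for q using le[OF that] by (simp add: le_fun_def)
      moreover have "u \<le> p"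
      proof -
        obtain q where "q \<in> C" using False by blast
        then show ?thesis using \<open>\<And>q. q \<in> C \<Longrightarrow> u \<le> q\<close> CA by (auto simp: A_def intro: order_trans)
      qed
      ultimately show ?thesis by (auto simp: A_def)
    qed
  qed
  then obtain q where q: "q \<in> A" "\<And>r. r \<in> A \<Longrightarrow> r \<le> q \<Longrightarrow> r = q" by blast
  show thesis
  proof (rule that[of q])
    show "sublinear q" "q \<le> p" using q by (auto simp: A_def)
    show "r = q" if "sublinear r" "r \<le> q" for r
      using that q \<open>q \<le> p\<close> by (auto simp: A_def intro: order_trans)
  qed
qed

text \<open>The functional is a minimal sublinear functional below \<open>p\<close>, so that nothing has to be extended from
  a subspace.\<close>

theorem Hahn_Banach_dominated:
  assumes p: "sublinear p"
  obtains f where "linear f" "\<And>y. f y \<le> p y" "f x = (p x :: real)"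
proof -
  obtain p' where p': "sublinear p'" "p' \<le> p" "p' (- x) \<le> - p x"
    using sublinear_reduce[OF p] .
  obtain q where q: "sublinear q" "q \<le> p'" and min: "\<And>r. sublinear r \<Longrightarrow> r \<le> q \<Longrightarrow> r = q"
    using minimal_sublinear_exists[OF p'(1)] by metis
  have odd: "q (- y) = - q y" for y
  proof -
    obtain r where "sublinear r" "r \<le> q" "r (- y) \<le> - q y" using sublinear_reduce[OF q(1)] .
    then have "q (- y) \<le> - q y" using min by metis
    then show ?thesis using sublinear_lower[OF q(1), of y] by simp
  qed
  have add: "q (y + z) = q y + q z" for y z
    using sublinear_add[OF q(1), of y z] sublinear_add[OF q(1), of "- y" "- z"]
      odd[of "y + z"] odd[of y] odd[of z] by simp
  have scale: "q (t *\<^sub>R y) = t *\<^sub>R q y" for t y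
  proof -
    consider "t > 0" | "t = 0" | "- t > 0" by linarith
    then show ?thesis
    proof cases
      case 3
      then have "q ((- t) *\<^sub>R y) = (- t) * q y" by (rule sublinear_scale[OF q(1)])
      then show ?thesis using odd[of "t *\<^sub>R y"] by simp
    qed (simp_all add: sublinear_scale[OF q(1)] sublinear_zero[OF q(1)])
  qed
  show thesis
  proof (rule that[of q])
    show "linear q" by (rule linearI) (simp_all add: add scale)
    show "q y \<le> p y" for y
      using q(2) p'(2) by (meson le_funD order_trans)
    then show "q x = p x"
      using le_funD[OF q(2), of "- x"] p'(3) odd[of x] by (intro antisym) simp_all
  qed
qed

lemma csubspace_scaleR: "csubspace M \<Longrightarrow> x \<in> M \<Longrightarrow> t *\<^sub>R x \<in> M"
  by (simp add: scaleR_scaleC complex_vector.subspace_scale)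

lemma sublinear_infdist:
  fixes M :: "'a::complex_normed_vector set"
  assumes M: "csubspace M"
  shows "sublinear (\<lambda>y. infdist y M)"
proof (rule sublinearI)
  have ne: "M \<noteq> {}" using complex_vector.subspace_0[OF M] by auto
  have ge: "c \<le> infdist y M" if "\<And>m. m \<in> M \<Longrightarrow> c \<le> dist y m" for c y
    unfolding infdist_notempty[OF ne] using that ne by (intro cINF_greatest) auto
  fix y z :: 'a
  have "infdist (y + z) M \<le> dist y m + dist z n" if "m \<in> M" "n \<in> M" for m n
  proof -
    have "infdist (y + z) M \<le> dist (y + z) (m + n)"
      using complex_vector.subspace_add[OF M that] by (rule infdist_le)
    also have "\<dots> \<le> dist y m + dist z n" by (rule dist_triangle_add)
    finally show ?thesis .
  qed
  then have "infdist (y + z) M - dist z n \<le> infdist y M" if "n \<in> M" for n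
    using that by (intro ge) (simp add: algebra_simps)
  then have "infdist (y + z) M - infdist y M \<le> infdist z M"
    by (intro ge) (simp add: algebra_simps)
  then show "infdist (y + z) M \<le> infdist y M + infdist z M" by simp
  fix t :: real assume t: "t > 0"
  have "infdist (t *\<^sub>R y) M / t \<le> infdist y M"
  proof (rule ge)
    fix m assume "m \<in> M"
    then have "infdist (t *\<^sub>R y) M \<le> dist (t *\<^sub>R y) (t *\<^sub>R m)"
      by (intro infdist_le csubspace_scaleR[OF M])
    also have "\<dots> = dist y m * t"
      using t by (simp add: dist_norm scaleR_diff_right[symmetric])
    finally show "infdist (t *\<^sub>R y) M / t \<le> dist y m" using t by (simp add: pos_divide_le_eq)
  qed
  then show "infdist (t *\<^sub>R y) M \<le> t * infdist y M" using t by (simp add: field_simps)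
qed

text \<open>The real functional comes from the sublinear function \<open>y \<mapsto> dist(y, M)\<close>, which vanishes exactly on \<open>M\<close>.
  The complex one is \<open>y \<mapsto> f y - i f(i y)\<close>, rescaled.\<close>

theorem Hahn_Banach_separation:
  fixes M :: "'a::complex_normed_vector set"
  assumes M: "csubspace M" "closed M" and x: "x \<notin> M"
  obtains \<phi> :: "'a \<Rightarrow> complex"
  where "bounded_clinear \<phi>" "\<And>y. y \<in> M \<Longrightarrow> \<phi> y = 0" "\<phi> x = 1"
proof -
  obtain f where f: "linear f" and le: "\<And>y. f y \<le> infdist y M" and fx: "f x = infdist x M"
    using Hahn_Banach_dominated[OF sublinear_infdist[OF M(1)]] by metis
  interpret f: linear f by (rule f)
  have ne: "M \<noteq> {}" using complex_vector.subspace_0[OF M(1)] by auto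
  have pos: "f x > 0"
    using infdist_pos_not_in_closed[OF M(2) ne x] fx by simp
  have f0: "f y = 0" if "y \<in> M" for y
    using le[of y] le[of "- y"] that complex_vector.subspace_neg[OF M(1) that] by (simp add: f.neg)
  have fle: "\<bar>f y\<bar> \<le> norm y" for y
  proof -
    have "infdist z M \<le> norm z" for z
      using infdist_le[OF complex_vector.subspace_0[OF M(1)], of z] by simp
    then show ?thesis
      using le[of y] le[of "- y"] by (metis abs_le_iff f.neg norm_minus_cancel order_trans)
  qed
  define \<psi> where "\<psi> y = Complex (f y) (- f (\<i> *\<^sub>C y))" for y
  have real: "f (complex_of_real r *\<^sub>C y) = r * f y" for r y
    using f.scale[of r y] by (simp add: scaleR_scaleC)
  have scale: "\<psi> (c *\<^sub>C y) = c * \<psi> y" for c y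
  proof -
    have c: "c *\<^sub>C z = complex_of_real (Re c) *\<^sub>C z + complex_of_real (Im c) *\<^sub>C (\<i> *\<^sub>C z)" for z :: 'a
      by (subst complex_eq[of c]) (simp only: scaleC_add_left scaleC_scaleC mult.commute)
    have ii: "\<i> *\<^sub>C \<i> *\<^sub>C y = - y"
      by (simp add: scaleC_scaleC complex_vector.scale_minus_left scaleC_one)
    have 1: "f (c *\<^sub>C y) = Re c * f y + Im c * f (\<i> *\<^sub>C y)"
      unfolding c[of y] f.add real ..
    have "f (\<i> *\<^sub>C c *\<^sub>C y) = f (c *\<^sub>C \<i> *\<^sub>C y)" by (simp add: scaleC_scaleC mult.commute)
    also have "\<dots> = Re c * f (\<i> *\<^sub>C y) - Im c * f y"
      unfolding c[of "\<i> *\<^sub>C y"] f.add real ii f.neg by simp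
    finally show ?thesis using 1 by (simp add: \<psi>_def complex_eq_iff)
  qed
  have "bounded_linear \<psi>"
  proof (rule bounded_linear_intro[of _ 2])
    show "\<psi> (y + z) = \<psi> y + \<psi> z" for y z
      by (simp add: \<psi>_def f.add scaleC_add_right complex_eq_iff)
    show "\<psi> (r *\<^sub>R y) = r *\<^sub>R \<psi> y" for r y
      by (simp add: scaleR_scaleC[of r y] scale scaleR_conv_of_real)
    have "cmod (\<psi> y) \<le> \<bar>f y\<bar> + \<bar>f (\<i> *\<^sub>C y)\<bar>" for y
      using cmod_le[of "\<psi> y"] by (simp add: \<psi>_def)
    moreover have "\<bar>f (\<i> *\<^sub>C y)\<bar> \<le> norm y" for y
      using fle[of "\<i> *\<^sub>C y"] by (simp add: norm_scaleC)
    ultimately show "cmod (\<psi> y) \<le> norm y * 2" for y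
      using fle[of y] by (smt (verit))
  qed
  then have \<psi>: "bounded_clinear \<psi>"
    using scale by (simp add: bounded_clinear_def scaleC_complex_def)
  have nz: "\<psi> x \<noteq> 0" using pos by (simp add: \<psi>_def complex_eq_iff)
  show thesis
  proof (rule that[of "\<lambda>y. \<psi> y / \<psi> x"])
    show "bounded_clinear (\<lambda>y. \<psi> y / \<psi> x)"
      unfolding bounded_clinear_def
      using bounded_linear_divide[THEN bounded_linear_compose, OF bounded_clinear_bounded_linear[OF \<psi>]]
      by (simp add: scale scaleC_complex_def)
    show "\<psi> y / \<psi> x = 0" if "y \<in> M" for y
    proof -
      have "\<psi> y = 0"
        using f0 that complex_vector.subspace_scale[OF M(1) that, of \<i>] by (simp add: \<psi>_def complex_eq_iff)
      then show ?thesis by simp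
    qed
    show "\<psi> x / \<psi> x = 1" using nz by simp
  qed
qed

section \<open>Closed subspaces of finite codimension or finite dimension\<close>

lemma bounded_clinear_continuous_on: "bounded_clinear f \<Longrightarrow> continuous_on S f"
  by (simp add: bounded_clinear_def linear_continuous_on)

lemma bounded_linear_scaleC_left:
  fixes x :: "'a::complex_normed_vector"
  shows "bounded_linear (\<lambda>c. c *\<^sub>C x)"
  by (rule bounded_linear_intro[of _ "norm x"])
    (simp_all add: scaleC_add_left norm_scaleC scaleR_scaleC[where 'a='a] scaleC_scaleC scaleR_conv_of_real)

lemma bounded_bilinear_scaleC:
  "bounded_bilinear (scaleC :: complex \<Rightarrow> 'a::complex_normed_vector \<Rightarrow> 'a)"
proof
  show "\<exists>K. \<forall>a b. norm (a *\<^sub>C b) \<le> norm a * norm (b::'a) * K"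
    by (intro exI[of _ 1]) (simp add: norm_scaleC)
qed (simp_all add: scaleC_add_left scaleC_add_right scaleR_scaleC[where 'a='a] scaleC_scaleC scaleR_conv_of_real mult.commute)

lemma closed_kernel:
  assumes "bounded_clinear T" shows "closed (kernel T)"
  unfolding kernel_def
  by (intro closed_Collect_eq bounded_clinear_continuous_on[OF assms] continuous_on_const)

text \<open>With a bounded functional \<open>\<phi>\<close> that vanishes on \<open>M\<close> and is \<open>1\<close> at \<open>x\<close>, the span is the preimage of \<open>M\<close>
  under the continuous map \<open>y \<mapsto> y - \<phi>(y) x\<close>.\<close>

lemma closed_span_insert:
  fixes M :: "'a::complex_normed_vector set"
  assumes M: "csubspace M" "closed M"
  shows "closed (cspan (insert x M))"
proof (cases "x \<in> M")
  case True
  then show ?thesis using M by (simp add: insert_absorb complex_vector.span_eq_iff[THEN iffD2])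
next
  case False
  obtain \<phi> :: "'a \<Rightarrow> complex" where \<phi>: "bounded_clinear \<phi>" "\<And>y. y \<in> M \<Longrightarrow> \<phi> y = 0" "\<phi> x = 1"
    by (rule Hahn_Banach_separation[OF M False]) blast
  have span: "cspan M = M" using M by (simp only: complex_vector.span_eq_iff)
  have "y \<in> cspan (insert x M) \<longleftrightarrow> y - \<phi> y *\<^sub>C x \<in> M" for y
  proof
    assume "y \<in> cspan (insert x M)"
    then obtain k where k: "y - k *\<^sub>C x \<in> M" using span by (auto simp: complex_vector.span_breakdown_eq)
    have "\<phi> (y - k *\<^sub>C x) = \<phi> y - k"
      using \<phi>(1,3) by (simp add: bounded_clinear_simps scaleC_complex_def)
    then show "y - \<phi> y *\<^sub>C x \<in> M" using k \<phi>(2)[OF k] by simp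
  next
    assume "y - \<phi> y *\<^sub>C x \<in> M"
    then show "y \<in> cspan (insert x M)" unfolding complex_vector.span_breakdown_eq span by blast
  qed
  then have "cspan (insert x M) = (\<lambda>y. y - \<phi> y *\<^sub>C x) -` M" by auto
  moreover have cont: "continuous_on UNIV (\<lambda>y. y - \<phi> y *\<^sub>C x)"
    by (intro continuous_intros bounded_linear.continuous_on[OF bounded_linear_scaleC_left]
        bounded_clinear_continuous_on \<phi>)
  ultimately show ?thesis using continuous_on_closed_vimage[THEN iffD1, OF closed_UNIV cont] M(2) by simp
qed

lemma closed_span_Un_finite:
  assumes "finite F" "csubspace M" "closed M"
  shows "closed (cspan (M \<union> F))"
  using assms(1)
proof (induction F rule: finite_induct)
  case empty
  then show ?case using assms by (simp add: complex_vector.span_eq_iff[THEN iffD2])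
next
  case (insert x F)
  have "cspan (M \<union> insert x F) = cspan (insert x (cspan (M \<union> F)))"
  proof (rule antisym)
    show "cspan (M \<union> insert x F) \<subseteq> cspan (insert x (cspan (M \<union> F)))"
      by (intro complex_vector.span_mono) (auto intro: complex_vector.span_base)
    have "cspan (M \<union> F) \<subseteq> cspan (M \<union> insert x F)" by (intro complex_vector.span_mono) auto
    then show "cspan (insert x (cspan (M \<union> F))) \<subseteq> cspan (M \<union> insert x F)"
      by (intro complex_vector.span_minimal) (auto intro: complex_vector.span_base)
  qed
  then show ?case using closed_span_insert[OF _ insert.IH] by simp
qed

lemma closed_span_finite: "finite F \<Longrightarrow> closed (cspan F)"
  using closed_span_Un_finite[of F "{0}"] complex_vector.span_insert_0[of F]
  by (simp add: complex_vector.subspace_def)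

lemma in_span_Un_finite_iff:
  assumes "csubspace M" "finite F"
  shows "x \<in> cspan (M \<union> F) \<longleftrightarrow> (\<exists>m\<in>M. \<exists>u. x = m + (\<Sum>b\<in>F. u b *\<^sub>C b))"
proof -
  have eq: "cspan M = M" using assms by (simp only: complex_vector.span_eq_iff)
  show ?thesis
    unfolding complex_vector.span_Un complex_vector.span_finite[OF assms(2)] eq by auto
qed

text \<open>The functional belonging to \<open>f\<close> separates \<open>f\<close> from the closed subspace spanned by \<open>M\<close> and the
  other elements of \<open>F\<close>.\<close>

lemma biorthogonal_functionals:
  fixes M :: "'a::complex_normed_vector set"
  assumes M: "csubspace M" "closed M" and F: "indep_mod M F"
  obtains \<phi> :: "'a \<Rightarrow> 'a \<Rightarrow> complex"
  where "\<And>f. f \<in> F \<Longrightarrow> bounded_clinear (\<phi> f)"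
    "\<And>f m. f \<in> F \<Longrightarrow> m \<in> M \<Longrightarrow> \<phi> f m = 0"
    "\<And>f u. f \<in> F \<Longrightarrow> \<phi> f (\<Sum>b\<in>F. u b *\<^sub>C b) = u f"
proof -
  have fin: "finite F" using F by (simp add: indep_mod_def)
  have ex: "\<exists>\<phi>::'a \<Rightarrow> complex. bounded_clinear \<phi> \<and> (\<forall>m\<in>M. \<phi> m = 0) \<and>
      (\<forall>u. \<phi> (\<Sum>b\<in>F. u b *\<^sub>C b) = u f)" if f: "f \<in> F" for f
  proof -
    let ?S = "cspan (M \<union> (F - {f}))"
    have "f \<notin> ?S"
    proof
      assume "f \<in> ?S"
      then obtain m u where mu: "m \<in> M" "f = m + (\<Sum>b\<in>F - {f}. u b *\<^sub>C b)"
        using in_span_Un_finite_iff[OF M(1)] fin by auto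
      define v where "v = (\<lambda>b. - u b)(f := 1)"
      have "(\<Sum>b\<in>F. v b *\<^sub>C b) = f + (\<Sum>b\<in>F - {f}. v b *\<^sub>C b)"
        using fin f by (simp add: sum.remove v_def scaleC_one)
      also have "(\<Sum>b\<in>F - {f}. v b *\<^sub>C b) = - (\<Sum>b\<in>F - {f}. u b *\<^sub>C b)"
        unfolding sum_negf[symmetric]
        by (intro sum.cong) (auto simp: v_def complex_vector.scale_minus_left)
      finally have "(\<Sum>b\<in>F. v b *\<^sub>C b) \<in> M"
        using mu by (metis add_diff_cancel_right' diff_conv_add_uminus)
      then have "v f = 0" using F f by (simp add: indep_mod_def)
      then show False by (simp add: v_def)
    qed
    then obtain \<phi> :: "'a \<Rightarrow> complex" where \<phi>: "bounded_clinear \<phi>" "\<And>y. y \<in> ?S \<Longrightarrow> \<phi> y = 0" "\<phi> f = 1"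
      using Hahn_Banach_separation[OF complex_vector.subspace_span closed_span_Un_finite[OF _ M]] fin
      by (metis finite_Diff)
    have "\<phi> b = 0" if "b \<in> F" "b \<noteq> f" for b
      using that by (intro \<phi>(2) complex_vector.span_base) auto
    then have "\<phi> (\<Sum>b\<in>F. u b *\<^sub>C b) = u f" for u
      using fin f \<phi>(1,3) by (simp add: bounded_clinear_simps scaleC_complex_def sum.remove)
    moreover have "\<forall>m\<in>M. \<phi> m = 0" by (auto intro: \<phi>(2) complex_vector.span_base)
    ultimately show ?thesis using \<phi>(1) by blast
  qed
  then obtain \<phi> :: "'a \<Rightarrow> 'a \<Rightarrow> complex" where "\<forall>f\<in>F. bounded_clinear (\<phi> f) \<and> (\<forall>m\<in>M. \<phi> f m = 0) \<and>
      (\<forall>u. \<phi> f (\<Sum>b\<in>F. u b *\<^sub>C b) = u f)"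
    by metis
  then show thesis using that by blast
qed

text \<open>If \<open>W\<close> is a complement of \<open>N\<close> and the functionals \<open>\<phi>\<^sub>f\<close> vanish on \<open>N\<close> and are dual to a basis \<open>F\<close> of
  \<open>N'\<close> modulo \<open>N\<close>, then the common kernel of the \<open>\<phi>\<^sub>f\<close> in \<open>W\<close> is a complement of \<open>N'\<close>.\<close>

lemma closed_complemented_mono_finite:
  fixes N :: "'a::complex_normed_vector set"
  assumes N: "csubspace N" "closed_complemented N"
    and N': "csubspace N'" "closed N'" "N \<subseteq> N'" and fin: "rel_dim N N' \<noteq> \<infinity>"
  shows "closed_complemented N'"
proof -
  obtain F where F: "F \<subseteq> N'" "indep_mod N F" "N' \<subseteq> cspan (N \<union> F)"
    using rel_dim_finite_basis[OF N(1)] fin by (metis not_infinity_eq)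
  have finF: "finite F" using F by (simp add: indep_mod_def)
  have clN: "closed N" using N(2) by (simp add: closed_complemented_def)
  obtain W where W: "csubspace W" "closed W" "N \<inter> W = {0}" "N + W = UNIV"
    using N(2) by (auto simp: closed_complemented_def)
  obtain \<phi> :: "'a \<Rightarrow> 'a \<Rightarrow> complex"
    where \<phi>: "\<And>f. f \<in> F \<Longrightarrow> bounded_clinear (\<phi> f)" "\<And>f m. f \<in> F \<Longrightarrow> m \<in> N \<Longrightarrow> \<phi> f m = 0"
      "\<And>f u. f \<in> F \<Longrightarrow> \<phi> f (\<Sum>b\<in>F. u b *\<^sub>C b) = u f"
    using biorthogonal_functionals[OF N(1) clN F(2)] by blast
  define Z where "Z = W \<inter> (\<Inter>f\<in>F. kernel (\<phi> f))"
  have "csubspace Z"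
    unfolding Z_def using W(1) \<phi>(1)
    by (intro complex_vector.subspace_inter complex_vector.subspace_Inter) (auto intro: csubspace_kernel)
  moreover have "closed Z"
    unfolding Z_def using W(2) \<phi>(1) by (intro closed_Int closed_INT ballI closed_kernel) auto
  moreover have "N' \<inter> Z = {0}"
  proof -
    have "y = 0" if y: "y \<in> N'" "y \<in> Z" for y
    proof -
      obtain n u where nu: "n \<in> N" "y = n + (\<Sum>b\<in>F. u b *\<^sub>C b)"
        using y F(3) in_span_Un_finite_iff[OF N(1) finF] by blast
      have "u f = 0" if "f \<in> F" for f
      proof -
        have "\<phi> f y = u f" unfolding nu(2) using \<phi> that nu(1) by (simp add: bounded_clinear_simps)
        then show ?thesis using y that by (auto simp: Z_def kernel_def)
      qed
      then have "y \<in> N" using nu by simp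
      then show ?thesis using y W(3) by (auto simp: Z_def)
    qed
    then show ?thesis
      using complex_vector.subspace_0[OF \<open>csubspace Z\<close>] complex_vector.subspace_0[OF N'(1)] by auto
  qed
  moreover have "N' + Z = UNIV"
  proof -
    have "x \<in> N' + Z" for x
    proof -
      let ?s = "\<Sum>b\<in>F. \<phi> b x *\<^sub>C b"
      have "x - ?s \<in> N + W" using W(4) by simp
      then obtain n w where nw: "n \<in> N" "w \<in> W" "x - ?s = n + w"
        by (rule set_plus_elim)
      have "\<phi> f w = 0" if "f \<in> F" for f
      proof -
        have "\<phi> f (x - ?s) = 0" using \<phi>(1)[OF that] \<phi>(3)[OF that] by (simp add: bounded_clinear_simps(2))
        then show ?thesis using nw \<phi>(1,2) that by (simp add: bounded_clinear_simps(1))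
      qed
      then have "w \<in> Z" using nw by (auto simp: Z_def kernel_def)
      moreover have "?s + n \<in> N'"
        using F(1) nw(1) N'(1,3)
        by (intro complex_vector.subspace_add complex_vector.subspace_sum complex_vector.subspace_scale) auto
      moreover have "x = (?s + n) + w" using nw(3) by (simp add: algebra_simps)
      ultimately show ?thesis by (metis set_plus_intro)
    qed
    then show ?thesis by auto
  qed
  ultimately show ?thesis using N'(2) by (auto simp: closed_complemented_def)
qed

text \<open>Here a complement of \<open>N\<close> is the span of a complement of \<open>N'\<close> and of a basis of \<open>N'\<close> modulo \<open>N\<close>.\<close>

lemma closed_complemented_antimono_finite:
  fixes N :: "'a::complex_normed_vector set"
  assumes N: "csubspace N" "closed N"
    and N': "csubspace N'" "closed_complemented N'" "N \<subseteq> N'" and fin: "rel_dim N N' \<noteq> \<infinity>"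
  shows "closed_complemented N"
proof -
  obtain F where F: "F \<subseteq> N'" "indep_mod N F" "N' \<subseteq> cspan (N \<union> F)"
    using rel_dim_finite_basis[OF N(1)] fin by (metis not_infinity_eq)
  have finF: "finite F" using F by (simp add: indep_mod_def)
  have sum: "(\<Sum>b\<in>F. u b *\<^sub>C b) \<in> N'" for u
    using F(1) N'(1) by (intro complex_vector.subspace_sum complex_vector.subspace_scale) auto
  obtain W where W: "csubspace W" "closed W" "N' \<inter> W = {0}" "N' + W = UNIV"
    using N'(2) by (auto simp: closed_complemented_def)
  let ?Z = "cspan (W \<union> F)"
  have "N \<inter> ?Z = {0}"
  proof -
    have "y = 0" if y: "y \<in> N" "y \<in> ?Z" for y
    proof -
      obtain w u where wu: "w \<in> W" "y = w + (\<Sum>b\<in>F. u b *\<^sub>C b)"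
        using y in_span_Un_finite_iff[OF W(1) finF] by blast
      have "w = y - (\<Sum>b\<in>F. u b *\<^sub>C b)" using wu by simp
      then have "w \<in> N'" using y(1) N'(3) complex_vector.subspace_diff[OF N'(1) _ sum[of u]] by auto
      then have "w = 0" using W(3) wu by auto
      then have "\<forall>b\<in>F. u b = 0" using wu y(1) F(2) by (simp add: indep_mod_def)
      then show ?thesis using wu \<open>w = 0\<close> by simp
    qed
    then show ?thesis using complex_vector.span_zero complex_vector.subspace_0[OF N(1)] by auto
  qed
  moreover have "N + ?Z = UNIV"
  proof -
    have "x \<in> N + ?Z" for x
    proof -
      have "x \<in> N' + W" using W(4) by simp
      then obtain n w where nw: "n \<in> N'" "w \<in> W" "x = n + w" by (rule set_plus_elim)
      obtain m u where mu: "m \<in> N" "n = m + (\<Sum>b\<in>F. u b *\<^sub>C b)"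
        using nw F(3) in_span_Un_finite_iff[OF N(1) finF] by blast
      have "w + (\<Sum>b\<in>F. u b *\<^sub>C b) \<in> ?Z"
        using in_span_Un_finite_iff[OF W(1) finF] nw(2) by blast
      then have "m + (w + (\<Sum>b\<in>F. u b *\<^sub>C b)) \<in> N + ?Z" using mu(1) by (intro set_plus_intro)
      then show ?thesis using nw mu by (simp add: algebra_simps)
    qed
    then show ?thesis by auto
  qed
  moreover have "closed ?Z" using closed_span_Un_finite[OF finF W(1,2)] .
  ultimately show ?thesis using N(2) unfolding closed_complemented_def
    using complex_vector.subspace_span by blast
qed

lemma closed_complemented_finite_dim:
  fixes N :: "'a::complex_normed_vector set"
  assumes "csubspace N" "closed N" "rel_dim {0} N \<noteq> \<infinity>"
  shows "closed_complemented N"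
proof (rule closed_complemented_mono_finite[of "{0}"])
  show "closed_complemented {0 :: 'a}"
    unfolding closed_complemented_def
    by (intro conjI exI[of _ UNIV]) (auto simp: set_zero_plus[unfolded elt_set_plus_def] set_plus_def)
  show "{0} \<subseteq> N" using complex_vector.subspace_0[OF assms(1)] by simp
qed (use assms in \<open>auto simp: complex_vector.subspace_def\<close>)

section \<open>The open mapping theorem and closed ranges\<close>

text \<open>Banach's argument. By Baire's theorem the closure of the image of some ball has interior points,
  so each \<open>y\<close> can be approximated up to \<open>\<parallel>y\<parallel>/2\<close> by the image of a point of norm at most \<open>K \<parallel>y\<parallel>\<close>; iterating on
  the error gives an exact preimage. Allowing a closed subspace \<open>D\<close> as the domain
  brings in spaces such as \<open>Q \<times> span W\<close>, whose dimension depends on the operator at hand.\<close>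

theorem open_mapping_bound:
  fixes f :: "'a::banach \<Rightarrow> 'b::banach"
  assumes f: "bounded_linear f" and D: "subspace D" "closed D" and onto: "f ` D = UNIV"
  obtains K where "K > 0" "\<And>y. \<exists>x\<in>D. f x = y \<and> norm x \<le> K * norm y"
proof -
  interpret f: bounded_linear f by (rule f)
  define E where "E n = closure (f ` (D \<inter> cball 0 (real n)))" for n
  have un: "(\<Union>n. E n) = UNIV"
  proof -
    have "y \<in> (\<Union>n. E n)" for y
    proof -
      obtain x where x: "x \<in> D" "f x = y" using onto by (metis UNIV_I imageE)
      obtain n where "norm x \<le> real n" using real_arch_simple by blast
      then have "y \<in> E n" unfolding E_def using x by (intro closure_subset[THEN subsetD]) auto
      then show ?thesis by blast
    qed
    then show ?thesis by auto
  qed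
  have "\<exists>n. interior (E n) \<noteq> {}"
  proof (rule ccontr)
    assume "\<not> ?thesis"
    then have "Met_TC.mtopology interior_of \<Union> (range E) = ({} :: 'b set)"
      by (intro Met_TC.metric_Baire_category_alt)
        (auto simp: E_def complete_UNIV mtopology_is_euclidean mcomplete_iff_complete)
    then show False using un by (simp add: mtopology_is_euclidean)
  qed
  then obtain n y0 e where e: "e > 0" "ball y0 e \<subseteq> E n"
    by (metis ex_in_conv mem_interior)
  define K where "K = 4 * (real n + 1) / e"
  have K: "K > 0" using e by (simp add: K_def add_nonneg_pos)
  have step: "\<exists>x\<in>D. norm x \<le> K * norm y \<and> norm (y - f x) \<le> norm y / 2" for y
  proof (cases "y = 0")
    case True
    then show ?thesis using subspace_0[OF D(1)] by (intro bexI[of _ 0]) (auto simp: f.zero)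
  next
    case False
    \<comment> \<open>Scale \<open>y\<close> to norm \<open>e / 2\<close>, so that \<open>y0 + y'\<close> lies in the ball.\<close>
    define c where "c = 2 * norm y / e"
    have c: "c > 0" using False e by (simp add: c_def)
    define y' where "y' = (1 / c) *\<^sub>R y"
    have ny': "norm y' = e / 2" using c False e by (simp add: y'_def c_def)
    have "y0 + y' \<in> E n" "y0 \<in> E n" using e ny' by (auto simp: dist_norm intro!: subsetD[OF e(2)])
    moreover have "\<exists>a\<in>D. norm a \<le> n \<and> dist (f a) z < e / 8" if z: "z \<in> E n" for z
    proof -
      have "0 < e / 8" using e by simp
      then obtain w where "w \<in> f ` (D \<inter> cball 0 n)" "dist w z < e / 8"
        using z unfolding E_def closure_approachable by blast
      then show ?thesis by auto
    qed
    ultimately obtain a b where ab: "a \<in> D" "norm a \<le> n" "dist (f a) (y0 + y') < e / 8"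
        "b \<in> D" "norm b \<le> n" "dist (f b) y0 < e / 8"
      by meson
    define x where "x = c *\<^sub>R (a - b)"
    have "x \<in> D" using ab D(1) by (simp add: x_def subspace_diff subspace_scale)
    moreover have "norm x \<le> K * norm y"
    proof -
      have "norm (a - b) \<le> 2 * (real n + 1)" using ab(2,5) norm_triangle_ineq4[of a b] by (simp add: algebra_simps)
      then have "norm x \<le> c * (2 * (real n + 1))" using c by (simp add: x_def)
      also have "\<dots> = K * norm y" by (simp add: c_def K_def)
      finally show ?thesis .
    qed
    moreover have "norm (y - f x) \<le> norm y / 2"
    proof -
      have "y' - f (a - b) = (y0 + y' - f a) - (y0 - f b)" by (simp add: f.diff)
      then have "norm (y' - f (a - b)) \<le> norm (y0 + y' - f a) + norm (y0 - f b)"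
        by (metis norm_triangle_ineq4)
      also have "\<dots> \<le> e / 4" using ab by (simp add: dist_norm norm_minus_commute)
      finally have "c * norm (y' - f (a - b)) \<le> c * (e / 4)" using c by simp
      moreover have "y - f x = c *\<^sub>R (y' - f (a - b))"
      proof -
        have "f x = c *\<^sub>R f (a - b)" unfolding x_def by (rule f.scaleR)
        then show ?thesis using c by (simp add: y'_def scaleR_diff_right)
      qed
      ultimately show ?thesis using c e by (simp add: c_def)
    qed
    ultimately show ?thesis by blast
  qed
  then obtain s where s: "\<And>y. s y \<in> D" "\<And>y. norm (s y) \<le> K * norm y" "\<And>y. norm (y - f (s y)) \<le> norm y / 2"
    by metis
  have "\<exists>x\<in>D. f x = y \<and> norm x \<le> (2 * K) * norm y" for y
  proof -
    \<comment> \<open>The part of \<open>y\<close> that is left after \<open>k\<close> approximation steps.\<close>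
    define r where "r k = ((\<lambda>z. z - f (s z)) ^^ k) y" for k
    have r: "norm (r k) \<le> norm y * (1/2) ^ k" for k
    proof (induction k)
      case (Suc k)
      then show ?case using s(3)[of "r k"] by (simp add: r_def)
    qed (simp add: r_def)
    have sr: "norm (s (r k)) \<le> K * norm y * (1/2) ^ k" for k
    proof -
      have "K * norm (r k) \<le> K * (norm y * (1/2) ^ k)" using r K by (intro mult_left_mono) auto
      then show ?thesis using s(2)[of "r k"] by (simp add: mult.assoc)
    qed
    have geo: "(\<lambda>k. K * norm y * (1/2) ^ k) sums (K * norm y * 2)"
      using sums_mult[OF geometric_sums[of "1/2 :: real"], of "K * norm y"] by simp
    have sm: "summable (\<lambda>k. s (r k))"
      by (rule summable_comparison_test'[OF sums_summable[OF geo], of 0]) (use sr in auto)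
    define x where "x = (\<Sum>k. s (r k))"
    have x: "(\<lambda>k. s (r k)) sums x" unfolding x_def using sm by (rule summable_sums)
    have "(\<lambda>n. \<Sum>k<n. s (r k)) \<longlonglongrightarrow> x" using x by (simp add: sums_def)
    then have "x \<in> D"
      by (rule closed_sequentially[OF D(2), rotated]) (auto intro: subspace_sum[OF D(1)] s(1))
    moreover have "norm x \<le> (2 * K) * norm y"
    proof -
      have "norm x \<le> (\<Sum>k. K * norm y * (1/2) ^ k)"
        unfolding x_def by (rule norm_suminf_le[OF sr sums_summable[OF geo]])
      then show ?thesis using sums_unique[OF geo] by (simp add: mult_ac)
    qed
    moreover have "f x = y"
    proof (rule sums_unique2)
      show "(\<lambda>k. f (s (r k))) sums f x" using f.sums[OF x] .
      have "r \<longlonglongrightarrow> 0"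
      proof (rule Lim_null_comparison)
        show "(\<lambda>k. norm y * (1/2) ^ k) \<longlonglongrightarrow> 0"
          by (intro tendsto_mult_right_zero LIMSEQ_realpow_zero) auto
        show "\<forall>\<^sub>F k in sequentially. norm (r k) \<le> norm y * (1/2) ^ k" using r by simp
      qed
      then have "(\<lambda>k. r k - r (Suc k)) sums (r 0 - 0)" by (rule telescope_sums')
      then show "(\<lambda>k. f (s (r k))) sums y" by (simp add: r_def)
    qed
    ultimately show ?thesis by blast
  qed
  moreover have "2 * K > 0" using K by simp
  ultimately show thesis using that by blast
qed

lemma csubspace_imp_subspace: "csubspace M \<Longrightarrow> subspace M"
  by (simp add: subspace_def complex_vector.subspace_def scaleR_scaleC)

text \<open>Apply the open mapping theorem to \<open>(x, v) \<mapsto> T x + v\<close> on \<open>Q \<times> span W\<close>.\<close>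

lemma open_mapping_finite_codim:
  fixes T :: "'a::complex_banach \<Rightarrow> 'b::complex_banach"
  assumes T: "bounded_clinear T" and Q: "csubspace Q" "closed Q" and W: "finite W"
    and onto: "\<And>y. \<exists>x\<in>Q. y - T x \<in> cspan W"
  obtains K where "K > 0"
    "\<And>y. \<exists>x\<in>Q. \<exists>v\<in>cspan W. T x + v = y \<and> norm x \<le> K * norm y \<and> norm v \<le> K * norm y"
proof -
  let ?f = "\<lambda>p. T (fst p) + snd p" and ?D = "Q \<times> cspan W"
  have "bounded_linear ?f"
    by (intro bounded_linear_add bounded_linear_compose[OF bounded_clinear_bounded_linear[OF T]]
        bounded_linear_fst bounded_linear_snd)
  moreover have "subspace ?D"
    using csubspace_imp_subspace[OF Q(1)] csubspace_imp_subspace[OF complex_vector.subspace_span[of W]]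
    by (rule subspace_Times)
  moreover have "closed ?D" using Q(2) closed_span_finite[OF W] by (rule closed_Times)
  moreover have "?f ` ?D = UNIV"
  proof -
    have "y \<in> ?f ` ?D" for y
    proof -
      obtain x where "x \<in> Q" "y - T x \<in> cspan W" using onto by blast
      then show ?thesis by (intro image_eqI[of _ _ "(x, y - T x)"]) auto
    qed
    then show ?thesis by auto
  qed
  ultimately obtain K where K: "K > 0" "\<And>y. \<exists>p\<in>?D. ?f p = y \<and> norm p \<le> K * norm y"
    by (rule open_mapping_bound) blast
  show thesis
  proof (rule that[OF K(1)])
    fix y
    obtain p where p: "p \<in> ?D" "?f p = y" "norm p \<le> K * norm y" using K(2) by blast
    moreover have "norm (fst p) \<le> norm p" "norm (snd p) \<le> norm p"
      by (metis norm_fst_le prod.collapse, metis norm_snd_le prod.collapse)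
    ultimately show "\<exists>x\<in>Q. \<exists>v\<in>cspan W. T x + v = y \<and> norm x \<le> K * norm y \<and> norm v \<le> K * norm y"
      by (intro bexI[of _ "fst p"] bexI[of _ "snd p"]) auto
  qed
qed

lemma range_complement_decomposition:
  assumes T: "bounded_clinear T" and W: "finite W" "cspan (range T \<union> W) = UNIV"
  shows "\<exists>x. y - T x \<in> cspan W"
proof -
  have "y \<in> cspan (range T \<union> W)" using W by simp
  then obtain x u where "y = T x + (\<Sum>b\<in>W. u b *\<^sub>C b)"
    using in_span_Un_finite_iff[OF csubspace_range[OF T] W(1)] by auto
  then show ?thesis
    by (intro exI[of _ x]) (auto intro: complex_vector.span_sum complex_vector.span_scale complex_vector.span_base)
qed

text \<open>If \<open>y\<^sub>n = T a\<^sub>n\<close> converges to \<open>l\<close>, split the small vector \<open>y\<^sub>n - l\<close> as \<open>T x' + v\<close> with \<open>v\<close> small in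
  the complement. As the sum is direct, \<open>- v\<close> is the component of \<open>l\<close> in the complement, so this
  component is arbitrarily small.\<close>

lemma closed_range_finite_codim:
  fixes T :: "'a::complex_banach \<Rightarrow> 'b::complex_banach"
  assumes T: "bounded_clinear T" and W: "indep_mod (range T) W" "cspan (range T \<union> W) = UNIV"
  shows "closed (range T)"
proof -
  have fin: "finite W" using W by (simp add: indep_mod_def)
  have disj: "v = 0" if "v \<in> cspan W" "v \<in> range T" for v
    using that W(1) by (auto simp: complex_vector.span_finite[OF fin] indep_mod_def)
  have onto: "\<exists>x\<in>UNIV. y - T x \<in> cspan W" for y
    using range_complement_decomposition[OF T fin W(2)] by blast
  obtain K where K: "K > 0"
    "\<And>y. \<exists>x\<in>UNIV. \<exists>v\<in>cspan W. T x + v = y \<and> norm x \<le> K * norm y \<and> norm v \<le> K * norm y"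
    using open_mapping_finite_codim[OF T _ _ fin onto] by (metis closed_UNIV complex_vector.subspace_UNIV)
  show ?thesis
    unfolding closed_sequential_limits
  proof (intro allI impI)
    fix Y l assume Y: "(\<forall>n. Y n \<in> range T) \<and> Y \<longlonglongrightarrow> l"
    obtain x where x: "l - T x \<in> cspan W" using onto by blast
    have "norm (l - T x) \<le> K * norm (Y n - l)" for n
    proof -
      obtain x' v where v: "v \<in> cspan W" "T x' + v = Y n - l" "norm v \<le> K * norm (Y n - l)"
        using K(2) by blast
      obtain a where a: "Y n = T a" using Y by blast
      have "(l - T x) + v = T (a - x - x')"
        using v(2) a by (simp add: bounded_clinear_simps[OF T] algebra_simps)
      then have "(l - T x) + v \<in> range T" by (metis rangeI)
      then have "(l - T x) + v = 0" using disj complex_vector.span_add[OF x v(1)] by blast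
      then have "l - T x = - v" by (simp add: eq_neg_iff_add_eq_0)
      then show ?thesis using v(3) by simp
    qed
    moreover have "(\<lambda>n. K * norm (Y n - l)) \<longlonglongrightarrow> K * 0"
      using Y by (intro tendsto_mult tendsto_const) (simp add: LIM_zero_iff tendsto_norm_zero_iff)
    ultimately have "norm (l - T x) \<le> K * 0"
      by (intro LIMSEQ_le_const) auto
    then show "l \<in> range T" by auto
  qed
qed

section \<open>Vector-valued analytic functions\<close>

lemma vector_analytic_on_subset:
  "vector_analytic_on f V \<Longrightarrow> U \<subseteq> V \<Longrightarrow> vector_analytic_on f U"
  unfolding vector_analytic_on_def by (meson has_derivative_subset subsetD)

lemma vector_analytic_on_const: "vector_analytic_on (\<lambda>_. x) V"
  unfolding vector_analytic_on_def by (intro ballI exI[of _ 0]) simp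

lemma vector_analytic_on_add:
  assumes "vector_analytic_on f V" "vector_analytic_on g V"
  shows "vector_analytic_on (\<lambda>z. f z + g z) V"
  unfolding vector_analytic_on_def
proof
  fix z assume "z \<in> V"
  then obtain d e where "(f has_derivative (\<lambda>h. h *\<^sub>C d)) (at z within V)"
    "(g has_derivative (\<lambda>h. h *\<^sub>C e)) (at z within V)"
    using assms unfolding vector_analytic_on_def by blast
  from has_derivative_add[OF this]
  show "\<exists>d. ((\<lambda>z. f z + g z) has_derivative (\<lambda>h. h *\<^sub>C d)) (at z within V)"
    by (intro exI[of _ "d + e"]) (simp add: scaleC_add_right)
qed

lemma vector_analytic_on_scaleC:
  assumes "vector_analytic_on g V" "vector_analytic_on f V"
  shows "vector_analytic_on (\<lambda>z. g z *\<^sub>C f z) V"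
  unfolding vector_analytic_on_def
proof
  fix z assume "z \<in> V"
  then obtain d e where "(g has_derivative (\<lambda>h. h *\<^sub>C e)) (at z within V)"
    "(f has_derivative (\<lambda>h. h *\<^sub>C d)) (at z within V)"
    using assms unfolding vector_analytic_on_def by blast
  from bounded_bilinear.FDERIV[OF bounded_bilinear_scaleC this]
  show "\<exists>d. ((\<lambda>z. g z *\<^sub>C f z) has_derivative (\<lambda>h. h *\<^sub>C d)) (at z within V)"
    by (intro exI[of _ "g z *\<^sub>C d + e *\<^sub>C f z"])
      (simp add: scaleC_add_right scaleC_scaleC scaleC_complex_def mult.commute)
qed

lemma vector_analytic_on_clinear:
  assumes T: "bounded_clinear T" and f: "vector_analytic_on f V"
  shows "vector_analytic_on (\<lambda>z. T (f z)) V"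
  unfolding vector_analytic_on_def
proof
  fix z assume "z \<in> V"
  then obtain d where "(f has_derivative (\<lambda>h. h *\<^sub>C d)) (at z within V)"
    using f unfolding vector_analytic_on_def by blast
  from bounded_linear.has_derivative[OF bounded_clinear_bounded_linear[OF T] this]
  show "\<exists>d. ((\<lambda>z. T (f z)) has_derivative (\<lambda>h. h *\<^sub>C d)) (at z within V)"
    by (intro exI[of _ "T d"]) (simp add: bounded_clinear_simps(5)[OF T])
qed

lemma vector_analytic_on_uminus:
  "vector_analytic_on f V \<Longrightarrow> vector_analytic_on (\<lambda>z. - f z) V"
  using vector_analytic_on_scaleC[OF vector_analytic_on_const[of "- 1 :: complex"], of f V]
  by (simp add: complex_vector.scale_minus_left scaleC_one)

lemma vector_analytic_on_sum:
  "(\<And>i. i \<in> I \<Longrightarrow> vector_analytic_on (f i) V) \<Longrightarrow> vector_analytic_on (\<lambda>z. \<Sum>i\<in>I. f i z) V"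
  by (induction I rule: infinite_finite_induct)
    (simp_all add: vector_analytic_on_const vector_analytic_on_add)

lemma vector_analytic_on_continuous: "vector_analytic_on f V \<Longrightarrow> continuous_on V f"
  unfolding vector_analytic_on_def continuous_on_eq_continuous_within
  using has_derivative_continuous by blast

text \<open>The series converges at least for \<open>\<parallel>z\<parallel> < 1/K\<close>; on half of this disc the series of derivatives is dominated
  by a multiple of \<open>\<Sum> n 2\<^sup>1\<^sup>-\<^sup>n\<close>, so that it may be differentiated term by term.\<close>

lemma power_series_vector_analytic:
  fixes x :: "nat \<Rightarrow> 'a::complex_banach"
  assumes K: "K > 0" and bound: "\<And>n. norm (x n) \<le> M * K ^ n"
  obtains G where "vector_analytic_on G (ball 0 (1 / (2 * K)))"
    "\<And>z. z \<in> ball 0 (1 / (2 * K)) \<Longrightarrow> (\<lambda>n. z ^ n *\<^sub>C x n) sums G z"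
proof -
  define S where "S = ball (0::complex) (1 / (2 * K))"
  define d where "d n z = (of_nat n * z ^ (n - 1)) *\<^sub>C x n" for n and z :: complex
  define D where "D z = (\<Sum>n. d n z)" for z
  define m where "m n = M * K * (of_nat n * (1/2) ^ (n - 1))" for n
  have d: "norm (d n z) \<le> m n" if z: "z \<in> S" for n z
  proof (cases n)
    case (Suc k)
    have "norm z ^ k \<le> (1 / (2 * K)) ^ k"
      using z by (intro power_mono) (auto simp: S_def)
    then have "norm z ^ k * norm (x n) \<le> (1 / (2 * K)) ^ k * (M * K ^ n)"
      using bound[of n] K by (intro mult_mono) auto
    also have "\<dots> = M * K * (1/2) ^ k"
      using K Suc by (simp add: power_divide power_mult_distrib)
    finally have "of_nat n * (norm z ^ k * norm (x n)) \<le> of_nat n * (M * K * (1/2) ^ k)"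
      by (intro mult_left_mono) auto
    moreover have "norm (d n z) = of_nat n * (norm z ^ k * norm (x n))"
      using Suc by (simp add: d_def norm_scaleC norm_mult norm_power del: of_nat_Suc)
    ultimately show ?thesis using Suc by (simp add: m_def mult_ac del: of_nat_Suc)
  qed (simp add: d_def m_def)
  have "summable (\<lambda>n. of_nat (Suc n) * (1/2 :: real) ^ n)"
    using geometric_deriv_sums[of "1/2 :: real"] by (intro sums_summable) auto
  then have "summable (\<lambda>n. of_nat n * (1/2 :: real) ^ (n - 1))"
    by (subst summable_Suc_iff[symmetric]) simp
  then have "summable m" unfolding m_def by (rule summable_mult)
  then have ul: "uniform_limit S (\<lambda>n z. \<Sum>i<n. d i z) D sequentially"
    unfolding D_def using d by (intro Weierstrass_m_test) auto
  have "\<exists>g. \<forall>z\<in>S. (\<lambda>n. z ^ n *\<^sub>C x n) sums g z \<and>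
      (g has_derivative (\<lambda>h. h *\<^sub>C D z)) (at z within S)"
  proof (rule has_derivative_series)
    show "convex S" by (simp add: S_def)
    show "0 \<in> S" using K by (simp add: S_def)
    have "(\<lambda>n. 0 ^ n *\<^sub>C x n) = (\<lambda>n. if n = 0 then x 0 else 0)"
      by (auto simp: fun_eq_iff scaleC_one)
    then show "(\<lambda>n. 0 ^ n *\<^sub>C x n) sums x 0" using sums_single[of 0 "\<lambda>_. x 0"] by simp
    show "((\<lambda>z. z ^ n *\<^sub>C x n) has_derivative (\<lambda>h. h *\<^sub>C d n z)) (at z within S)" for n z
    proof -
      have "((\<lambda>z. z ^ n) has_derivative (\<lambda>h. h * (of_nat n * z ^ (n - 1)))) (at z within S)"
        by (auto intro!: derivative_eq_intros simp: mult_ac)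
      from bounded_linear.has_derivative[OF bounded_linear_scaleC_left[of "x n"] this]
      show ?thesis by (simp add: d_def scaleC_scaleC)
    qed
    fix e :: real assume "e > 0"
    then have "\<forall>\<^sub>F n in sequentially. \<forall>z\<in>S. dist (\<Sum>i<n. d i z) (D z) < e"
      using ul by (simp add: uniform_limit_iff)
    then show "\<forall>\<^sub>F n in sequentially. \<forall>z\<in>S. \<forall>h.
        norm ((\<Sum>i<n. h *\<^sub>C d i z) - h *\<^sub>C D z) \<le> e * norm h"
    proof (eventually_elim, intro ballI allI)
      fix n z and h :: complex
      assume "\<forall>z\<in>S. dist (\<Sum>i<n. d i z) (D z) < e" "z \<in> S"
      then have "norm ((\<Sum>i<n. d i z) - D z) \<le> e" by (simp add: dist_norm less_imp_le)
      moreover have "(\<Sum>i<n. h *\<^sub>C d i z) - h *\<^sub>C D z = h *\<^sub>C ((\<Sum>i<n. d i z) - D z)"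
        by (simp add: complex_vector.scale_right_diff_distrib complex_vector.scale_sum_right)
      ultimately show "norm ((\<Sum>i<n. h *\<^sub>C d i z) - h *\<^sub>C D z) \<le> e * norm h"
        by (simp add: norm_scaleC mult.commute[of e] mult_left_mono)
    qed
  qed
  then show thesis using that unfolding S_def vector_analytic_on_def by blast
qed

lemma csubspace_sums_mem:
  assumes M: "csubspace M" "closed M" and x: "\<And>n. x n \<in> M" and s: "x sums s"
  shows "s \<in> M"
proof -
  have "(\<Sum>i<n. x i) \<in> M" for n using x by (intro complex_vector.subspace_sum[OF M(1)]) auto
  moreover have "(\<lambda>n. \<Sum>i<n. x i) \<longlonglongrightarrow> s" using s by (simp add: sums_def)
  ultimately show ?thesis by (rule closed_sequentially[OF M(2)])
qed

text \<open>Solve \<open>(T - \<mu>) g(\<mu>) \<in> W\<close> by a power series \<open>g(\<mu>) = \<Sum> \<mu>\<^sup>n x\<^sub>n\<close>: comparing coefficients leaves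
  \<open>T x\<^sub>n\<^sub>+\<^sub>1 + v\<^sub>n\<^sub>+\<^sub>1 = x\<^sub>n\<close>, which can be solved recursively with geometric growth of the norms. Choosing
  \<open>x\<^sub>n \<in> Q\<close> for \<open>n \<ge> 1\<close> keeps the component of \<open>g\<close> outside \<open>Q\<close> constant.\<close>

lemma local_eigenfunction_modulo:
  fixes T :: "'a::complex_banach \<Rightarrow> 'a"
  assumes T: "bounded_clinear T" and Q: "csubspace Q" "closed Q" and W: "csubspace W" "closed W"
    and K: "K > 0"
      "\<And>y. \<exists>x\<in>Q. \<exists>v\<in>W. T x + v = y \<and> norm x \<le> K * norm y \<and> norm v \<le> K * norm y"
    and z: "T z = 0"
  obtains g h where "vector_analytic_on g (ball 0 (1 / (2 * K)))"
    "vector_analytic_on h (ball 0 (1 / (2 * K)))"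
    "\<And>\<mu>. \<mu> \<in> ball 0 (1 / (2 * K)) \<Longrightarrow> h \<mu> \<in> W \<and> g \<mu> - z \<in> Q \<and> T (g \<mu>) + h \<mu> = \<mu> *\<^sub>C g \<mu>"
proof -
  obtain sx sv where s: "\<And>y. sx y \<in> Q" "\<And>y. sv y \<in> W" "\<And>y. T (sx y) + sv y = y"
    "\<And>y. norm (sx y) \<le> K * norm y" "\<And>y. norm (sv y) \<le> K * norm y"
    using K(2) by metis
  define x where "x n = (sx ^^ n) z" for n
  \<comment> \<open>The error term vanishes at \<open>\<mu> = 0\<close>, because \<open>T z = 0\<close> exactly.\<close>
  define v where "v n = (case n of 0 \<Rightarrow> 0 | Suc k \<Rightarrow> sv (x k))" for n
  have rec: "T (x (Suc n)) + v (Suc n) = x n" for n by (simp add: x_def v_def s(3))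
  have nx: "norm (x n) \<le> norm z * K ^ n" for n
  proof (induction n)
    case (Suc n)
    have "norm (x (Suc n)) \<le> K * norm (x n)" by (simp add: x_def s(4))
    also have "\<dots> \<le> K * (norm z * K ^ n)" using Suc K by (intro mult_left_mono) auto
    finally show ?case by (simp add: mult_ac)
  qed (simp add: x_def)
  have nv: "norm (v n) \<le> norm z * K ^ n" for n
  proof (cases n)
    case (Suc k)
    have "norm (v n) \<le> K * norm (x k)" by (simp add: v_def s(5) Suc)
    also have "\<dots> \<le> K * (norm z * K ^ k)" using nx K by (intro mult_left_mono) auto
    finally show ?thesis by (simp add: mult_ac Suc)
  qed (simp add: v_def)
  obtain g where g: "vector_analytic_on g (ball 0 (1 / (2 * K)))"
    "\<And>\<mu>. \<mu> \<in> ball 0 (1 / (2 * K)) \<Longrightarrow> (\<lambda>n. \<mu> ^ n *\<^sub>C x n) sums g \<mu>"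
    using power_series_vector_analytic[OF K(1) nx] by blast
  obtain h where h: "vector_analytic_on h (ball 0 (1 / (2 * K)))"
    "\<And>\<mu>. \<mu> \<in> ball 0 (1 / (2 * K)) \<Longrightarrow> (\<lambda>n. \<mu> ^ n *\<^sub>C v n) sums h \<mu>"
    using power_series_vector_analytic[OF K(1) nv] by blast
  have "h \<mu> \<in> W \<and> g \<mu> - z \<in> Q \<and> T (g \<mu>) + h \<mu> = \<mu> *\<^sub>C g \<mu>" if \<mu>: "\<mu> \<in> ball 0 (1 / (2 * K))" for \<mu>
  proof (intro conjI)
    have "v n \<in> W" for n
      using s(2) complex_vector.subspace_0[OF W(1)] by (cases n) (auto simp: v_def)
    then show "h \<mu> \<in> W"
      by (intro csubspace_sums_mem[OF W _ h(2)[OF \<mu>]] complex_vector.subspace_scale[OF W(1)])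
    have "(\<lambda>n. \<mu> ^ Suc n *\<^sub>C x (Suc n)) sums (g \<mu> - z)"
      using g(2)[OF \<mu>] by (subst sums_Suc_iff) (simp add: x_def scaleC_one)
    moreover have "x (Suc n) \<in> Q" for n using s(1) by (simp add: x_def)
    then have "\<mu> ^ Suc n *\<^sub>C x (Suc n) \<in> Q" for n by (intro complex_vector.subspace_scale[OF Q(1)])
    ultimately show "g \<mu> - z \<in> Q"
      by (rule csubspace_sums_mem[OF Q, rotated])
    have "(\<lambda>n. T (\<mu> ^ n *\<^sub>C x n) + \<mu> ^ n *\<^sub>C v n) sums (T (g \<mu>) + h \<mu>)"
      by (intro sums_add h(2)[OF \<mu>] bounded_linear.sums[OF bounded_clinear_bounded_linear[OF T]] g(2)[OF \<mu>])
    moreover have "(\<lambda>n. T (\<mu> ^ n *\<^sub>C x n) + \<mu> ^ n *\<^sub>C v n) sums (\<mu> *\<^sub>C g \<mu>)"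
    proof -
      have "bounded_linear (\<lambda>y::'a. \<mu> *\<^sub>C y)"
        by (rule bounded_bilinear.bounded_linear_right[OF bounded_bilinear_scaleC])
      from bounded_linear.sums[OF this g(2)[OF \<mu>]]
      have "(\<lambda>n. \<mu> ^ Suc n *\<^sub>C x n) sums (\<mu> *\<^sub>C g \<mu>)" by (simp add: scaleC_scaleC)
      moreover have "\<mu> ^ Suc n *\<^sub>C x n = T (\<mu> ^ Suc n *\<^sub>C x (Suc n)) + \<mu> ^ Suc n *\<^sub>C v (Suc n)" for n
        unfolding bounded_clinear_simps(5)[OF T] scaleC_add_right[symmetric] rec ..
      ultimately have "(\<lambda>n. T (\<mu> ^ Suc n *\<^sub>C x (Suc n)) + \<mu> ^ Suc n *\<^sub>C v (Suc n)) sums (\<mu> *\<^sub>C g \<mu>)"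
        by simp
      then show ?thesis
        by (subst (asm) sums_Suc_iff) (simp add: x_def v_def z scaleC_one)
    qed
    ultimately show "T (g \<mu>) + h \<mu> = \<mu> *\<^sub>C g \<mu>" by (rule sums_unique2)
  qed
  then show thesis using that g(1) h(1) by blast
qed

text \<open>Gaussian elimination over analytic functions: more than \<open>card W\<close> analytic functions with values in
  \<open>span W\<close> satisfy a pointwise nontrivial relation with analytic coefficients. The pivot is a
  coordinate function that is nonzero at some point; it stays nonzero on a smaller open set, and
  shrinking is harmless because a failure of the SVEP may be witnessed by any small open set.\<close>

lemma analytic_linear_relation:
  fixes h :: "'i \<Rightarrow> complex \<Rightarrow> 'a::complex_banach"
  assumes "finite W" "finite I" "card W < card I" "open V" "V \<noteq> {}"
    and "\<And>i. i \<in> I \<Longrightarrow> vector_analytic_on (h i) V"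
    and "\<And>i \<mu>. i \<in> I \<Longrightarrow> \<mu> \<in> V \<Longrightarrow> h i \<mu> \<in> cspan W"
  shows "\<exists>U c. open U \<and> U \<noteq> {} \<and> U \<subseteq> V \<and> (\<forall>i\<in>I. vector_analytic_on (c i) U) \<and>
    (\<forall>\<mu>\<in>U. (\<exists>i\<in>I. c i \<mu> \<noteq> (0::complex)) \<and> (\<Sum>i\<in>I. c i \<mu> *\<^sub>C h i \<mu>) = 0)"
  using assms
proof (induction W arbitrary: I V h rule: finite_induct)
  case empty
  then have "\<forall>i\<in>I. \<forall>\<mu>\<in>V. h i \<mu> = 0" "I \<noteq> {}" by auto
  then show ?case
    using empty.prems by (intro exI[of _ V] exI[of _ "\<lambda>_ _. 1"]) (auto simp: vector_analytic_on_const)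
next
  case (insert w W)
  have card: "card W < card I" using insert.hyps insert.prems(2) by simp
  show ?case
  proof (cases "w \<in> cspan W")
    case True
    then have "cspan (insert w W) = cspan W" by (rule complex_vector.span_redundant)
    then have "h i \<mu> \<in> cspan W" if "i \<in> I" "\<mu> \<in> V" for i \<mu>
      using insert.prems(6)[OF that] by simp
    then show ?thesis
      by (intro insert.IH[OF insert.prems(1) card insert.prems(3,4)]) (simp_all add: insert.prems(5))
  next
    case False
    obtain \<phi> :: "'a \<Rightarrow> complex" where \<phi>: "bounded_clinear \<phi>" "\<And>y. y \<in> cspan W \<Longrightarrow> \<phi> y = 0" "\<phi> w = 1"
      using Hahn_Banach_separation[OF complex_vector.subspace_span closed_span_finite[OF insert.hyps(1)] False]
      by blast
    have span_iff: "y \<in> cspan W" if y: "y \<in> cspan (insert w W)" "\<phi> y = 0" for y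
    proof -
      obtain k where k: "y - k *\<^sub>C w \<in> cspan W"
        using y(1) unfolding complex_vector.span_breakdown_eq by blast
      have "\<phi> (y - k *\<^sub>C w) = - k"
        using \<phi>(1,3) y(2) by (simp add: bounded_clinear_simps scaleC_complex_def)
      then have "k = 0" using \<phi>(2)[OF k] by simp
      then show ?thesis using k by simp
    qed
    define a where "a i \<mu> = \<phi> (h i \<mu>)" for i \<mu>
    have a: "vector_analytic_on (a i) V" if "i \<in> I" for i
      unfolding a_def by (intro vector_analytic_on_clinear[OF \<phi>(1)] insert.prems(5) that)
    show ?thesis
    proof (cases "\<forall>i\<in>I. \<forall>\<mu>\<in>V. a i \<mu> = 0")
      case True
      then have "h i \<mu> \<in> cspan W" if "i \<in> I" "\<mu> \<in> V" for i \<mu>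
        using that insert.prems(6) span_iff by (simp add: a_def)
      then show ?thesis
        by (intro insert.IH[OF insert.prems(1) card insert.prems(3,4)]) (simp_all add: insert.prems(5))
    next
      case False
      then obtain j \<mu>0 where j: "j \<in> I" "\<mu>0 \<in> V" "a j \<mu>0 \<noteq> 0" by blast
      define V1 where "V1 = {\<mu>\<in>V. a j \<mu> \<noteq> 0}"
      have "open (V \<inter> a j -` (- {0}))"
        using insert.prems(3) vector_analytic_on_continuous[OF a[OF j(1)]]
        by (intro continuous_open_preimage) auto
      moreover have "V1 = V \<inter> a j -` (- {0})" by (auto simp: V1_def)
      ultimately have V1: "open V1" "V1 \<noteq> {}" "V1 \<subseteq> V" using j by (auto simp: V1_def)
      \<comment> \<open>Cross-multiplied elimination, so that no quotient of analytic functions is needed.\<close>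
      define k where "k i \<mu> = a j \<mu> *\<^sub>C h i \<mu> + - (a i \<mu> *\<^sub>C h j \<mu>)" for i \<mu>
      have k: "vector_analytic_on (k i) V1" if "i \<in> I - {j}" for i
        unfolding k_def
        by (intro vector_analytic_on_subset[OF _ V1(3)] vector_analytic_on_add
            vector_analytic_on_uminus vector_analytic_on_scaleC a insert.prems(5))
          (use that j in auto)
      have kW: "k i \<mu> \<in> cspan W" if "i \<in> I - {j}" "\<mu> \<in> V1" for i \<mu>
      proof (rule span_iff)
        have "h i \<mu> \<in> cspan (insert w W)" "h j \<mu> \<in> cspan (insert w W)"
          using that j(1) V1(3) insert.prems(6) by auto
        then show "k i \<mu> \<in> cspan (insert w W)"
          unfolding k_def
          by (intro complex_vector.span_add complex_vector.span_neg complex_vector.span_scale)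
        show "\<phi> (k i \<mu>) = 0"
          by (simp add: k_def bounded_clinear_simps[OF \<phi>(1)] scaleC_complex_def a_def)
      qed
      have "card W < card (I - {j})" "finite (I - {j})"
        using insert.hyps insert.prems(1,2) j(1) by simp_all
      from insert.IH[OF this(2,1) V1(1,2), of k]
      have "\<exists>U c. open U \<and> U \<noteq> {} \<and> U \<subseteq> V1 \<and> (\<forall>i\<in>I - {j}. vector_analytic_on (c i) U) \<and>
        (\<forall>\<mu>\<in>U. (\<exists>i\<in>I - {j}. c i \<mu> \<noteq> (0::complex)) \<and> (\<Sum>i\<in>I - {j}. c i \<mu> *\<^sub>C k i \<mu>) = 0)"
        using k kW by simp
      then obtain U c where U: "open U" "U \<noteq> {}" "U \<subseteq> V1"
        and cU: "\<forall>i\<in>I - {j}. vector_analytic_on (c i) U"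
          "\<forall>\<mu>\<in>U. (\<exists>i\<in>I - {j}. c i \<mu> \<noteq> 0) \<and> (\<Sum>i\<in>I - {j}. c i \<mu> *\<^sub>C k i \<mu>) = 0"
        by (elim exE conjE)
      have c: "\<And>i. i \<in> I - {j} \<Longrightarrow> vector_analytic_on (c i) U"
          "\<And>\<mu>. \<mu> \<in> U \<Longrightarrow> \<exists>i\<in>I - {j}. c i \<mu> \<noteq> 0"
          "\<And>\<mu>. \<mu> \<in> U \<Longrightarrow> (\<Sum>i\<in>I - {j}. c i \<mu> *\<^sub>C k i \<mu>) = 0"
        using cU by blast+
      define c' where "c' i = (if i = j then (\<lambda>\<mu>. - (\<Sum>i\<in>I - {j}. c i \<mu> *\<^sub>C a i \<mu>)) else (\<lambda>\<mu>. c i \<mu> *\<^sub>C a j \<mu>))" for i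
      have aU: "vector_analytic_on (a i) U" if "i \<in> I" for i
        using a[OF that] U(3) V1(3) vector_analytic_on_subset by blast
      have "vector_analytic_on (c' i) U" if "i \<in> I" for i
        unfolding c'_def using that j(1)
        by (auto intro!: vector_analytic_on_uminus vector_analytic_on_sum vector_analytic_on_scaleC c(1) aU)
      moreover have "\<exists>i\<in>I. c' i \<mu> \<noteq> 0" if "\<mu> \<in> U" for \<mu>
        using c(2)[OF that] U(3) that by (auto simp: c'_def V1_def scaleC_complex_def)
      moreover have "(\<Sum>i\<in>I. c' i \<mu> *\<^sub>C h i \<mu>) = 0" if \<mu>: "\<mu> \<in> U" for \<mu>
      proof -
        have "(\<Sum>i\<in>I. c' i \<mu> *\<^sub>C h i \<mu>) = c' j \<mu> *\<^sub>C h j \<mu> + (\<Sum>i\<in>I - {j}. c' i \<mu> *\<^sub>C h i \<mu>)"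
          using insert.prems(1) j(1) by (simp add: sum.remove)
        also have "(\<Sum>i\<in>I - {j}. c' i \<mu> *\<^sub>C h i \<mu>) = (\<Sum>i\<in>I - {j}. (c i \<mu> * a j \<mu>) *\<^sub>C h i \<mu>)"
          by (intro sum.cong) (auto simp: c'_def scaleC_complex_def)
        also have "c' j \<mu> *\<^sub>C h j \<mu> = (\<Sum>i\<in>I - {j}. - ((c i \<mu> * a i \<mu>) *\<^sub>C h j \<mu>))"
          by (simp add: c'_def scaleC_complex_def complex_vector.scale_minus_left
              complex_vector.scale_sum_left sum_negf)
        also have "\<dots> + (\<Sum>i\<in>I - {j}. (c i \<mu> * a j \<mu>) *\<^sub>C h i \<mu>) = (\<Sum>i\<in>I - {j}. c i \<mu> *\<^sub>C k i \<mu>)"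
          unfolding sum.distrib[symmetric]
          by (intro sum.cong) (simp_all add: k_def complex_vector.scale_right_diff_distrib scaleC_scaleC)
        finally show ?thesis using c(3)[OF \<mu>] by simp
      qed
      ultimately show ?thesis using U V1(3) by (intro exI[of _ U] exI[of _ c']) blast
    qed
  qed
qed

section \<open>The single valued extension property bounds the index\<close>

lemma SVEP_atE:
  assumes "SVEP_at T l"
  obtains r where "r > 0"
    "\<And>V f \<mu>. open V \<Longrightarrow> V \<subseteq> ball l r \<Longrightarrow> vector_analytic_on f V \<Longrightarrow>
      (\<And>\<mu>. \<mu> \<in> V \<Longrightarrow> T (f \<mu>) - \<mu> *\<^sub>C f \<mu> = 0) \<Longrightarrow> \<mu> \<in> V \<Longrightarrow> f \<mu> = 0"
proof -
  obtain r where r: "r > 0" and all: "\<forall>V. open V \<and> V \<subseteq> ball l r \<longrightarrow>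
    (\<forall>f. vector_analytic_on f V \<and> (\<forall>m\<in>V. T (f m) - m *\<^sub>C f m = 0) \<longrightarrow> (\<forall>m\<in>V. f m = 0))"
    using assms unfolding SVEP_at_def by (elim exE conjE)
  show thesis
  proof (rule that[OF r])
    fix V f \<mu>
    assume "open V" "V \<subseteq> ball l r" "vector_analytic_on f V" "\<mu> \<in> V"
      and "\<And>\<mu>. \<mu> \<in> V \<Longrightarrow> T (f \<mu>) - \<mu> *\<^sub>C f \<mu> = 0"
    then show "f \<mu> = 0" using all[rule_format, of V f \<mu>] by simp
  qed
qed

text \<open>The eigenfunctions modulo \<open>W\<close> that start at the elements of \<open>Z\<close> have fewer than \<open>card Z\<close> degrees of
  freedom in their error terms, so some nontrivial combination has no error at all. It does not
  vanish, since \<open>Q\<close> is taken as a complement of the span of \<open>Z\<close>: the \<open>Z\<close>-coordinates of the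
  combination are its coefficients.\<close>

theorem SVEP_fails_of_positive_index:
  fixes T :: "'a::complex_banach \<Rightarrow> 'a"
  assumes T: "bounded_clinear T" and W: "finite W" "\<And>y. \<exists>x. y - T x \<in> cspan W"
    and Z: "Z \<subseteq> kernel T" "indep_mod {0} Z" and card: "card W < card Z"
  shows "\<not> SVEP_at T 0"
proof
  assume "SVEP_at T 0"
  then obtain r where r: "r > 0" and svep: "\<And>V f \<mu>. open V \<Longrightarrow> V \<subseteq> ball 0 r \<Longrightarrow>
      vector_analytic_on f V \<Longrightarrow> (\<And>\<mu>. \<mu> \<in> V \<Longrightarrow> T (f \<mu>) - \<mu> *\<^sub>C f \<mu> = 0) \<Longrightarrow> \<mu> \<in> V \<Longrightarrow> f \<mu> = 0"
    by (rule SVEP_atE) blast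
  have finZ: "finite Z" using Z by (simp add: indep_mod_def)
  have s0: "csubspace {0 :: 'a}" by (simp add: complex_vector.subspace_def)
  obtain \<phi> :: "'a \<Rightarrow> 'a \<Rightarrow> complex"
    where \<phi>: "\<And>f. f \<in> Z \<Longrightarrow> bounded_clinear (\<phi> f)" "\<And>f m. f \<in> Z \<Longrightarrow> m \<in> {0} \<Longrightarrow> \<phi> f m = 0"
      "\<And>f u. f \<in> Z \<Longrightarrow> \<phi> f (\<Sum>b\<in>Z. u b *\<^sub>C b) = u f"
    using biorthogonal_functionals[OF s0 closed_singleton Z(2)] by blast
  \<comment> \<open>Subtracting elements of \<open>span Z \<subseteq> N(T)\<close> moves any \<open>x\<close> into \<open>Q\<close> without changing \<open>T x\<close>.\<close>
  define Q where "Q = (\<Inter>f\<in>Z. kernel (\<phi> f))"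
  have Q: "csubspace Q" "closed Q"
    unfolding Q_def using \<phi>(1)
    by (auto intro!: complex_vector.subspace_Inter csubspace_kernel closed_INT closed_kernel)
  have onto: "\<exists>x\<in>Q. y - T x \<in> cspan W" for y
  proof -
    obtain x where x: "y - T x \<in> cspan W" using W(2) by blast
    define x' where "x' = x - (\<Sum>b\<in>Z. \<phi> b x *\<^sub>C b)"
    have "T x' = T x"
      using Z(1) by (auto simp: x'_def bounded_clinear_simps[OF T] kernel_def intro!: sum.neutral)
    moreover have "x' \<in> Q"
      using \<phi>(1,3) by (auto simp: Q_def kernel_def x'_def bounded_clinear_simps(2))
    ultimately show ?thesis using x by (intro bexI[of _ x']) simp_all
  qed
  obtain K where K: "K > 0"
    "\<And>y. \<exists>x\<in>Q. \<exists>v\<in>cspan W. T x + v = y \<and> norm x \<le> K * norm y \<and> norm v \<le> K * norm y"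
    using open_mapping_finite_codim[OF T Q W(1) onto] by blast
  have "\<exists>g h. vector_analytic_on g (ball 0 (1 / (2 * K))) \<and>
    vector_analytic_on h (ball 0 (1 / (2 * K))) \<and>
    (\<forall>\<mu>\<in>ball 0 (1 / (2 * K)). h \<mu> \<in> cspan W \<and> g \<mu> - z \<in> Q \<and> T (g \<mu>) + h \<mu> = \<mu> *\<^sub>C g \<mu>)"
    if "z \<in> Z" for z
  proof -
    have "T z = 0" using Z(1) that by (auto simp: kernel_def)
    then show ?thesis
      using local_eigenfunction_modulo[OF T Q complex_vector.subspace_span closed_span_finite[OF W(1)] K]
      by metis
  qed
  then obtain g h where gh: "\<And>z. z \<in> Z \<Longrightarrow> vector_analytic_on (g z) (ball 0 (1 / (2 * K)))"
    "\<And>z. z \<in> Z \<Longrightarrow> vector_analytic_on (h z) (ball 0 (1 / (2 * K)))"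
    "\<And>z \<mu>. z \<in> Z \<Longrightarrow> \<mu> \<in> ball 0 (1 / (2 * K)) \<Longrightarrow> h z \<mu> \<in> cspan W \<and> g z \<mu> - z \<in> Q \<and>
       T (g z \<mu>) + h z \<mu> = \<mu> *\<^sub>C g z \<mu>"
    by metis
  define V where "V = ball (0::complex) (min r (1 / (2 * K)))"
  have V: "open V" "V \<noteq> {}" "V \<subseteq> ball 0 r" "V \<subseteq> ball 0 (1 / (2 * K))"
  proof -
    have "min r (1 / (2 * K)) > 0" using r K(1) by simp
    then show "V \<noteq> {}" unfolding V_def by (metis centre_in_ball empty_iff)
  qed (auto simp: V_def)
  obtain U c where U: "open U" "U \<noteq> {}" "U \<subseteq> V"
    and c: "\<And>z. z \<in> Z \<Longrightarrow> vector_analytic_on (c z) U" "\<And>\<mu>. \<mu> \<in> U \<Longrightarrow> \<exists>z\<in>Z. c z \<mu> \<noteq> (0::complex)"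
      "\<And>\<mu>. \<mu> \<in> U \<Longrightarrow> (\<Sum>z\<in>Z. c z \<mu> *\<^sub>C h z \<mu>) = 0"
  proof -
    have "\<exists>U c. open U \<and> U \<noteq> {} \<and> U \<subseteq> V \<and> (\<forall>i\<in>Z. vector_analytic_on (c i) U) \<and>
      (\<forall>\<mu>\<in>U. (\<exists>i\<in>Z. c i \<mu> \<noteq> (0::complex)) \<and> (\<Sum>i\<in>Z. c i \<mu> *\<^sub>C h i \<mu>) = 0)"
    proof (rule analytic_linear_relation[OF W(1) finZ card V(1,2)])
      show "vector_analytic_on (h z) V" if "z \<in> Z" for z
        using gh(2)[OF that] V(4) by (rule vector_analytic_on_subset)
      show "h z \<mu> \<in> cspan W" if "z \<in> Z" "\<mu> \<in> V" for z \<mu>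
        using gh(3) V(4) that by blast
    qed
    then show thesis using that by blast
  qed
  define G where "G \<mu> = (\<Sum>z\<in>Z. c z \<mu> *\<^sub>C g z \<mu>)" for \<mu>
  have Ub: "U \<subseteq> ball 0 (1 / (2 * K))" using U V by blast
  have "vector_analytic_on G U"
    unfolding G_def using Ub
    by (intro vector_analytic_on_sum vector_analytic_on_scaleC c(1) vector_analytic_on_subset[OF gh(1)])
  moreover have "T (G \<mu>) - \<mu> *\<^sub>C G \<mu> = 0" if \<mu>: "\<mu> \<in> U" for \<mu>
  proof -
    have "T (G \<mu>) = (\<Sum>z\<in>Z. c z \<mu> *\<^sub>C (\<mu> *\<^sub>C g z \<mu> - h z \<mu>))"
      unfolding G_def bounded_clinear_simps[OF T]
    proof (intro sum.cong refl)
      fix z assume "z \<in> Z"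
      then have "T (g z \<mu>) + h z \<mu> = \<mu> *\<^sub>C g z \<mu>" using gh(3) \<mu> Ub by blast
      then have "T (g z \<mu>) = \<mu> *\<^sub>C g z \<mu> - h z \<mu>" by (simp add: algebra_simps)
      then show "c z \<mu> *\<^sub>C T (g z \<mu>) = c z \<mu> *\<^sub>C (\<mu> *\<^sub>C g z \<mu> - h z \<mu>)" by simp
    qed
    also have "\<dots> = \<mu> *\<^sub>C G \<mu> - (\<Sum>z\<in>Z. c z \<mu> *\<^sub>C h z \<mu>)"
      by (simp add: G_def complex_vector.scale_right_diff_distrib sum_subtractf
          complex_vector.scale_sum_right scaleC_scaleC mult.commute)
    finally show ?thesis using c(3)[OF \<mu>] by simp
  qed
  moreover obtain \<mu> where \<mu>: "\<mu> \<in> U" using U(2) by blast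
  ultimately have "G \<mu> = 0" using svep[of U G \<mu>] U V by blast
  obtain z where z: "z \<in> Z" "c z \<mu> \<noteq> 0" using c(2)[OF \<mu>] by blast
  have "G \<mu> = (\<Sum>b\<in>Z. c b \<mu> *\<^sub>C b) + (\<Sum>b\<in>Z. c b \<mu> *\<^sub>C (g b \<mu> - b))"
    by (simp add: G_def sum.distrib[symmetric] scaleC_add_right[symmetric])
  moreover have "(\<Sum>b\<in>Z. c b \<mu> *\<^sub>C (g b \<mu> - b)) \<in> Q"
    using gh(3) \<mu> Ub by (intro complex_vector.subspace_sum[OF Q(1)] complex_vector.subspace_scale[OF Q(1)]) auto
  ultimately have "\<phi> z (G \<mu>) = c z \<mu>"
    using \<phi>(1,3)[OF z(1)] z(1) by (simp add: bounded_clinear_simps(1) Q_def kernel_def)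
  then show False using z \<open>G \<mu> = 0\<close> bounded_clinear_simps(4)[OF \<phi>(1)[OF z(1)]] by simp
qed

lemma nullity_eq_rel_dim: "bounded_clinear T \<Longrightarrow> nullity T = rel_dim {0} (kernel T)"
  by (simp add: nullity_def cdim_eq_rel_dim csubspace_kernel)

lemma deficiency_eq_rel_dim: "bounded_clinear T \<Longrightarrow> deficiency T = rel_dim (range T) UNIV"
  by (simp add: deficiency_def quot_dim_eq_rel_dim csubspace_range)

lemma deficiency_finite_complement:
  assumes T: "bounded_clinear T" and n: "deficiency T = enat n"
  obtains W where "finite W" "card W = n" "indep_mod (range T) W" "cspan (range T \<union> W) = UNIV"
proof -
  obtain W where "indep_mod (range T) W" "card W = n" "UNIV \<subseteq> cspan (range T \<union> W)"
    using rel_dim_finite_basis[OF csubspace_range[OF T]] n[unfolded deficiency_eq_rel_dim[OF T]] by metis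
  then show thesis using that by (auto simp: indep_mod_def)
qed

theorem SVEP_nullity_le_deficiency:
  fixes T :: "'a::complex_banach \<Rightarrow> 'a"
  assumes T: "bounded_clinear T" and svep: "SVEP_at T 0" and fin: "deficiency T < \<infinity>"
  shows "nullity T \<le> deficiency T"
proof (rule ccontr)
  obtain n where n: "deficiency T = enat n" using fin by (cases "deficiency T") auto
  assume "\<not> ?thesis"
  then have "enat (Suc n) \<le> rel_dim {0} (kernel T)"
    using n by (simp add: nullity_eq_rel_dim[OF T] Suc_ile_eq not_le)
  then obtain Z where Z: "Z \<subseteq> kernel T" "indep_mod {0} Z" "card Z = Suc n"
    unfolding enat_le_rel_dim_iff by blast
  obtain W where W: "finite W" "card W = n" "cspan (range T \<union> W) = UNIV"
    using deficiency_finite_complement[OF T n] by blast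
  have "\<not> SVEP_at T 0"
    by (rule SVEP_fails_of_positive_index[OF T W(1) range_complement_decomposition[OF T W(1,3)] Z(1,2)])
      (simp add: W Z)
  then show False using svep by blast
qed

lemma SVEP_at_shift:
  assumes "SVEP_at T l" shows "SVEP_at (\<lambda>x. T x - l *\<^sub>C x) 0"
proof -
  obtain r where r: "r > 0" and svep: "\<And>V f \<mu>. open V \<Longrightarrow> V \<subseteq> ball l r \<Longrightarrow>
      vector_analytic_on f V \<Longrightarrow> (\<And>\<mu>. \<mu> \<in> V \<Longrightarrow> T (f \<mu>) - \<mu> *\<^sub>C f \<mu> = 0) \<Longrightarrow> \<mu> \<in> V \<Longrightarrow> f \<mu> = 0"
    using assms by (rule SVEP_atE) blast
  show ?thesis
    unfolding SVEP_at_def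
  proof (intro exI[of _ r] conjI allI impI ballI)
    fix V f \<mu>
    assume V: "open V \<and> V \<subseteq> ball 0 r"
      and f: "vector_analytic_on f V \<and> (\<forall>m\<in>V. T (f m) - l *\<^sub>C f m - m *\<^sub>C f m = 0)"
      and \<mu>: "\<mu> \<in> V"
    let ?V = "(\<lambda>z. l + z) ` V"
    have "f (\<mu> + l - l) = 0"
    proof (rule svep[of ?V "\<lambda>z. f (z - l)"])
      show "open ?V" using V by (simp add: open_translation)
      show "?V \<subseteq> ball l r" using V by (auto simp: dist_norm)
      show "vector_analytic_on (\<lambda>z. f (z - l)) ?V"
        unfolding vector_analytic_on_def
      proof
        fix z assume z: "z \<in> ?V"
        then have "z - l \<in> V" by auto
        then obtain d where d: "(f has_derivative (\<lambda>h. h *\<^sub>C d)) (at (z - l) within V)"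
          using f unfolding vector_analytic_on_def by blast
        have "at (z - l) within V = at (z - l)"
          using V \<open>z - l \<in> V\<close> by (intro at_within_open) auto
        with d have "(f has_derivative (\<lambda>h. h *\<^sub>C d)) (at (z - l))" by (rule subst[rotated])
        moreover have "((\<lambda>z. z - l) has_derivative (\<lambda>h. h)) (at z within ?V)"
          by (auto intro!: derivative_eq_intros)
        ultimately have "((\<lambda>z. f (z - l)) has_derivative (\<lambda>h. h *\<^sub>C d)) (at z within ?V)"
          using has_derivative_compose[of "\<lambda>z. z - l" "\<lambda>h. h" z ?V f "\<lambda>h. h *\<^sub>C d"] by simp
        then show "\<exists>d. ((\<lambda>z. f (z - l)) has_derivative (\<lambda>h. h *\<^sub>C d)) (at z within ?V)" by blast
      qed
      show "T (f (m - l)) - m *\<^sub>C f (m - l) = 0" if "m \<in> ?V" for m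
      proof -
        have "m - l \<in> V" using that by auto
        then have "T (f (m - l)) - l *\<^sub>C f (m - l) - (m - l) *\<^sub>C f (m - l) = 0" using f by blast
        then show ?thesis by (simp add: complex_vector.scale_left_diff_distrib)
      qed
      show "\<mu> + l \<in> ?V" using \<mu> by (auto simp: add.commute)
    qed
    then show "f \<mu> = 0" by simp
  qed (rule r)
qed

section \<open>The dual operator\<close>

lemma cdual_eqI: "(\<And>x. cdual_apply f x = cdual_apply g x) \<Longrightarrow> f = g"
  by transfer (rule blinfun_eqI)

lemma bounded_clinear_cdual_apply: "bounded_clinear (cdual_apply f)"
  by transfer

lemma cdual_apply_simps:
  "cdual_apply 0 x = 0" "cdual_apply (f + g) x = cdual_apply f x + cdual_apply g x"
  "cdual_apply (f - g) x = cdual_apply f x - cdual_apply g x"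
  "cdual_apply (c *\<^sub>C f) x = c * cdual_apply f x"
  by (transfer; simp add: blinfun.bilinear_simps bounded_linear_Blinfun_apply[OF scaleC_blinfun_bounded_linear])+

lemma cdual_apply_sum: "cdual_apply (sum f F) x = (\<Sum>i\<in>F. cdual_apply (f i) x)"
  by (induction F rule: infinite_finite_induct) (simp_all add: cdual_apply_simps)

lemma cdual_of_functional:
  assumes "bounded_clinear \<phi>" obtains f where "\<And>x. cdual_apply f x = \<phi> x"
proof (rule that)
  have "blinfun_apply (Blinfun \<phi>) = \<phi>"
    using assms by (simp add: bounded_clinear_def bounded_linear_Blinfun_apply)
  then show "cdual_apply (Abs_cdual (Blinfun \<phi>)) x = \<phi> x" for x
    using assms by (simp add: cdual_apply.rep_eq Abs_cdual_inverse)
qed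

lemma norm_cdual_apply_le: "norm (cdual_apply f x) \<le> norm f * norm x"
  by transfer (rule norm_blinfun)

lemma norm_cdual_le:
  "0 \<le> b \<Longrightarrow> (\<And>x. norm (cdual_apply f x) \<le> b * norm x) \<Longrightarrow> norm f \<le> b"
  by transfer (rule norm_blinfun_bound)

lemma bounded_clinear_dual_op:
  assumes T: "bounded_clinear T" shows "bounded_clinear (dual_op T)"
proof -
  obtain K where K: "K \<ge> 0" "\<And>x. norm (T x) \<le> norm x * K"
    using bounded_linear.nonneg_bounded[OF bounded_clinear_bounded_linear[OF T]] by blast
  have scale: "dual_op T (c *\<^sub>C f) = c *\<^sub>C dual_op T f" for c f
    by (rule cdual_eqI) (simp add: cdual_apply_dual_op[OF T] cdual_apply_simps)
  have "bounded_linear (dual_op T)"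
  proof (rule bounded_linear_intro[of _ K])
    show "dual_op T (f + g) = dual_op T f + dual_op T g" for f g
      by (rule cdual_eqI) (simp add: cdual_apply_dual_op[OF T] cdual_apply_simps)
    show "dual_op T (r *\<^sub>R f) = r *\<^sub>R dual_op T f" for r f
      by (simp add: scaleR_scaleC scale)
    show "norm (dual_op T f) \<le> norm f * K" for f
    proof (rule norm_cdual_le)
      fix x
      have "norm (cdual_apply f (T x)) \<le> norm f * norm (T x)" by (rule norm_cdual_apply_le)
      also have "\<dots> \<le> norm f * (norm x * K)" using K by (intro mult_left_mono) auto
      finally show "norm (cdual_apply (dual_op T f) x) \<le> norm f * K * norm x"
        by (simp add: cdual_apply_dual_op[OF T] mult_ac)
    qed (use K in simp)
  qed
  then show ?thesis using scale by (simp add: bounded_clinear_def)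
qed

lemma bounded_clinear_shift:
  assumes "bounded_clinear T" shows "bounded_clinear (\<lambda>x. T x - l *\<^sub>C x)"
  using assms unfolding bounded_clinear_def
  by (auto intro!: bounded_linear_sub bounded_bilinear.bounded_linear_right[OF bounded_bilinear_scaleC]
      simp: complex_vector.scale_right_diff_distrib scaleC_scaleC mult.commute)

lemma dual_op_shift:
  assumes T: "bounded_clinear T"
  shows "dual_op (\<lambda>x. T x - l *\<^sub>C x) = (\<lambda>f. dual_op T f - l *\<^sub>C f)"
proof (intro ext cdual_eqI)
  fix f x
  have "bounded_clinear (\<lambda>x. T x - l *\<^sub>C x)" by (rule bounded_clinear_shift[OF T])
  then show "cdual_apply (dual_op (\<lambda>x. T x - l *\<^sub>C x) f) x = cdual_apply (dual_op T f - l *\<^sub>C f) x"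
    by (simp add: cdual_apply_dual_op T cdual_apply_simps scaleC_complex_def
        bounded_clinear_simps[OF bounded_clinear_cdual_apply])
qed

text \<open>A functional \<open>g\<close> that vanishes on \<open>N(B)\<close> factors through \<open>B\<close> on the range of \<open>B\<close>; extend it by \<open>0\<close> on the
  complement \<open>span W\<close>. The open mapping theorem provides preimages \<open>s y\<close> of controlled norm, which
  makes the extension bounded.\<close>

lemma annihilator_kernel_in_range_dual:
  fixes B :: "'b::complex_banach \<Rightarrow> 'b"
  assumes B: "bounded_clinear B" and W: "indep_mod (range B) W" "cspan (range B \<union> W) = UNIV"
    and g: "\<And>x. x \<in> kernel B \<Longrightarrow> cdual_apply g x = 0"
  shows "g \<in> range (dual_op B)"
proof -
  have fin: "finite W" using W by (simp add: indep_mod_def)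
  have onto: "\<exists>x\<in>UNIV. y - B x \<in> cspan W" for y
    using range_complement_decomposition[OF B fin W(2)] by blast
  obtain K where K: "K > 0"
    "\<And>y. \<exists>x\<in>UNIV. \<exists>v\<in>cspan W. B x + v = y \<and> norm x \<le> K * norm y \<and> norm v \<le> K * norm y"
    using open_mapping_finite_codim[OF B _ _ fin onto] by (metis closed_UNIV complex_vector.subspace_UNIV)
  obtain s where s: "\<And>y. y - B (s y) \<in> cspan W" "\<And>y. norm (s y) \<le> K * norm y"
    using K(2) by (metis add_diff_cancel_left')
  note Blin = bounded_clinear_simps[OF B]
    and glin = bounded_clinear_simps[OF bounded_clinear_cdual_apply[of g]]
  have disj: "B x = 0" if x: "B x \<in> cspan W" for x
  proof -
    obtain u where u: "B x = (\<Sum>b\<in>W. u b *\<^sub>C b)"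
      using x by (auto simp: complex_vector.span_finite[OF fin])
    then have "(\<Sum>b\<in>W. u b *\<^sub>C b) \<in> range B" by (metis rangeI)
    then have "\<forall>b\<in>W. u b = 0" using W(1) by (simp add: indep_mod_def)
    then show ?thesis using u by simp
  qed
  have uniq: "cdual_apply g (s y) = cdual_apply g x" if "y - B x \<in> cspan W" for x y
  proof -
    have "(y - B x) - (y - B (s y)) \<in> cspan W" using that s(1) by (rule complex_vector.span_diff)
    then have "B (s y - x) \<in> cspan W" by (simp add: Blin)
    then have "s y - x \<in> kernel B" using disj by (simp add: kernel_def)
    then have "cdual_apply g (s y - x) = 0" by (rule g)
    then show ?thesis by (simp add: glin)
  qed
  have scale: "cdual_apply g (s (c *\<^sub>C y)) = c * cdual_apply g (s y)" for c y
  proof -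
    have "c *\<^sub>C (y - B (s y)) \<in> cspan W" using s(1) by (rule complex_vector.span_scale)
    then have "c *\<^sub>C y - B (c *\<^sub>C s y) \<in> cspan W" by (simp add: Blin complex_vector.scale_right_diff_distrib)
    from uniq[OF this] show ?thesis by (simp add: glin scaleC_complex_def)
  qed
  have "bounded_linear (\<lambda>y. cdual_apply g (s y))"
  proof (rule bounded_linear_intro[of _ "norm g * K"])
    fix y z
    have "(y - B (s y)) + (z - B (s z)) \<in> cspan W" using s(1) by (intro complex_vector.span_add)
    then have "(y + z) - B (s y + s z) \<in> cspan W" by (simp add: Blin algebra_simps)
    from uniq[OF this] show "cdual_apply g (s (y + z)) = cdual_apply g (s y) + cdual_apply g (s z)"
      by (simp add: glin)
    show "cdual_apply g (s (r *\<^sub>R y)) = r *\<^sub>R cdual_apply g (s y)" for r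
      by (simp add: scaleR_scaleC[of r y] scale scaleR_conv_of_real)
    have "norm (cdual_apply g (s y)) \<le> norm g * norm (s y)" by (rule norm_cdual_apply_le)
    also have "\<dots> \<le> norm g * (K * norm y)" using s(2) by (intro mult_left_mono) auto
    finally show "norm (cdual_apply g (s y)) \<le> norm y * (norm g * K)" by (simp add: mult_ac)
  qed
  then have "bounded_clinear (\<lambda>y. cdual_apply g (s y))"
    using scale by (simp add: bounded_clinear_def scaleC_complex_def)
  then obtain f where f: "\<And>y. cdual_apply f y = cdual_apply g (s y)" using cdual_of_functional by blast
  have "g = dual_op B f"
  proof (rule cdual_eqI)
    fix x
    have "B x - B x \<in> cspan W" by (simp add: complex_vector.span_zero)
    from uniq[OF this] show "cdual_apply g x = cdual_apply (dual_op B f) x"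
      by (simp add: cdual_apply_dual_op[OF B] f)
  qed
  then show ?thesis by blast
qed

text \<open>If \<open>\<alpha>(B) < \<beta>(B)\<close> then \<open>B\<^sup>*\<close> has positive index: functionals that vanish on the closed range of \<open>B\<close> and
  are dual to a basis of a complement give \<open>\<beta>(B)\<close> independent elements of the kernel of \<open>B\<^sup>*\<close>,
  while functionals dual to a basis of \<open>N(B)\<close> span a complement of the range of \<open>B\<^sup>*\<close>.\<close>

theorem dual_SVEP_deficiency_le_nullity:
  fixes B :: "'b::complex_banach \<Rightarrow> 'b"
  assumes B: "bounded_clinear B" and svep: "SVEP_at (dual_op B) 0"
    and fin: "nullity B < \<infinity>" "deficiency B < \<infinity>"
  shows "deficiency B \<le> nullity B"
proof (rule ccontr)
  assume neg: "\<not> ?thesis"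
  obtain n where n: "deficiency B = enat n" using fin by (cases "deficiency B") auto
  obtain m where m: "nullity B = enat m" using fin by (cases "nullity B") auto
  have mn: "m < n" using neg m n by simp
  obtain F where F: "finite F" "card F = n" "indep_mod (range B) F" "cspan (range B \<union> F) = UNIV"
    using deficiency_finite_complement[OF B n] .
  have cl: "closed (range B)" by (rule closed_range_finite_codim[OF B F(3,4)])
  obtain \<phi> :: "'b \<Rightarrow> 'b \<Rightarrow> complex" where \<phi>: "\<And>f. f \<in> F \<Longrightarrow> bounded_clinear (\<phi> f)"
    "\<And>f y. f \<in> F \<Longrightarrow> y \<in> range B \<Longrightarrow> \<phi> f y = 0" "\<And>f u. f \<in> F \<Longrightarrow> \<phi> f (\<Sum>b\<in>F. u b *\<^sub>C b) = u f"
    using biorthogonal_functionals[OF csubspace_range[OF B] cl F(3)] by blast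
  have delta: "\<phi> f b = (if f = b then 1 else 0)" if "f \<in> F" "b \<in> F" for f b
    using \<phi>(3)[OF that(1), of "\<lambda>a. if a = b then 1 else 0"]
    by (simp add: sum_scaleC_delta[OF F(1) that(2)])
  have "\<forall>f\<in>F. \<exists>d. \<forall>x. cdual_apply d x = \<phi> f x" using \<phi>(1) cdual_of_functional by metis
  then obtain d where d: "\<And>f x. f \<in> F \<Longrightarrow> cdual_apply (d f) x = \<phi> f x" by metis
  have inj: "inj_on d F"
  proof (rule inj_onI)
    fix f b assume fb: "f \<in> F" "b \<in> F" "d f = d b"
    then have "\<phi> f f = \<phi> b f" using d by metis
    then show "f = b" using fb delta by (auto split: if_splits)
  qed
  have Zker: "d ` F \<subseteq> kernel (dual_op B)"
  proof
    fix y assume "y \<in> d ` F"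
    then obtain f where f: "f \<in> F" "y = d f" by blast
    have "dual_op B (d f) = 0"
      by (rule cdual_eqI) (simp add: cdual_apply_dual_op[OF B] d f \<phi>(2) cdual_apply_simps)
    then show "y \<in> kernel (dual_op B)" using f by (simp add: kernel_def)
  qed
  have Zind: "indep_mod {0} (d ` F)"
    unfolding indep_mod_def
  proof (intro conjI allI impI ballI)
    show "finite (d ` F)" using F(1) by simp
    fix u b assume u: "(\<Sum>b\<in>d ` F. u b *\<^sub>C b) \<in> {0}" and "b \<in> d ` F"
    then obtain f where f: "f \<in> F" "b = d f" by blast
    have "0 = cdual_apply (\<Sum>b\<in>d ` F. u b *\<^sub>C b) f" using u by (simp add: cdual_apply_simps)
    also have "\<dots> = (\<Sum>a\<in>F. u (d a) * \<phi> a f)"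
      by (simp add: sum.reindex[OF inj] cdual_apply_sum cdual_apply_simps d)
    also have "\<dots> = (\<Sum>a\<in>F. if a = f then u (d a) else 0)"
      using f by (intro sum.cong) (auto simp: delta)
    also have "\<dots> = u b" using F(1) f by simp
    finally show "u b = 0" by simp
  qed
  obtain E where E: "E \<subseteq> kernel B" "indep_mod {0} E" "card E = m" "kernel B \<subseteq> cspan ({0} \<union> E)"
    using rel_dim_finite_basis[of "{0}" "kernel B" m] m nullity_eq_rel_dim[OF B]
    by (auto simp: complex_vector.subspace_def)
  have finE: "finite E" using E by (simp add: indep_mod_def)
  have s0: "csubspace {0 :: 'b}" by (simp add: complex_vector.subspace_def)
  obtain \<psi> :: "'b \<Rightarrow> 'b \<Rightarrow> complex" where \<psi>: "\<And>f. f \<in> E \<Longrightarrow> bounded_clinear (\<psi> f)"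
    "\<And>f m. f \<in> E \<Longrightarrow> m \<in> {0} \<Longrightarrow> \<psi> f m = 0"
    "\<And>f u. f \<in> E \<Longrightarrow> \<psi> f (\<Sum>b\<in>E. u b *\<^sub>C b) = u f"
    using biorthogonal_functionals[OF s0 closed_singleton E(2)] by blast
  have "\<forall>f\<in>E. \<exists>d. \<forall>x. cdual_apply d x = \<psi> f x" using \<psi>(1) cdual_of_functional by metis
  then obtain e where e: "\<And>f x. f \<in> E \<Longrightarrow> cdual_apply (e f) x = \<psi> f x" by metis
  have onto: "\<exists>f. g - dual_op B f \<in> cspan (e ` E)" for g
  proof -
    define k where "k = (\<Sum>b\<in>E. cdual_apply g b *\<^sub>C e b)"
    have kE: "k \<in> cspan (e ` E)"
      unfolding k_def
      by (intro complex_vector.span_sum complex_vector.span_scale complex_vector.span_base) auto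
    have "g - k \<in> range (dual_op B)"
    proof (rule annihilator_kernel_in_range_dual[OF B F(3,4)])
      fix x assume "x \<in> kernel B"
      then obtain u where x: "x = (\<Sum>b\<in>E. u b *\<^sub>C b)"
        using E(4) in_span_Un_finite_iff[OF s0 finE] by fastforce
      have "cdual_apply k x = (\<Sum>b\<in>E. cdual_apply g b * u b)"
        unfolding k_def cdual_apply_sum cdual_apply_simps
        by (intro sum.cong refl) (simp add: e x \<psi>(3))
      also have "\<dots> = cdual_apply g x"
        by (simp add: x bounded_clinear_simps[OF bounded_clinear_cdual_apply] scaleC_complex_def mult.commute)
      finally show "cdual_apply (g - k) x = 0" by (simp add: cdual_apply_simps)
    qed
    then obtain f where "g - k = dual_op B f" by blast
    then have "g - dual_op B f = k" by (simp add: algebra_simps)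
    then show ?thesis using kE by metis
  qed
  have "card (e ` E) < card (d ` F)"
    using card_image_le[OF finE, of e] card_image[OF inj] E(3) F(2) mn by simp
  then have "\<not> SVEP_at (dual_op B) 0"
    by (intro SVEP_fails_of_positive_index[OF bounded_clinear_dual_op[OF B] _ onto Zker Zind])
      (use finE in auto)
  then show False using svep by blast
qed

section \<open>Upper triangular operators\<close>

lemma bounded_clinear_fst: "bounded_clinear fst"
  and bounded_clinear_snd: "bounded_clinear snd"
  and bounded_clinear_Pair_0: "bounded_clinear (\<lambda>x. (x, 0))"
  by (simp_all add: bounded_clinear_def bounded_linear_fst bounded_linear_snd scaleC_prod_def
      bounded_linear_Pair bounded_linear_ident bounded_linear_zero)

lemma bounded_clinear_upper_op:
  assumes A: "bounded_clinear A" and B: "bounded_clinear B" and C: "bounded_clinear C"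
  shows "bounded_clinear (upper_op A C B)"
  unfolding bounded_clinear_def
proof
  have eq: "upper_op A C B = (\<lambda>p. (A (fst p) + C (snd p), B (snd p)))"
    by (auto simp: upper_op_def)
  show "bounded_linear (upper_op A C B)"
    unfolding eq
    by (intro bounded_linear_Pair bounded_linear_add
        bounded_linear_compose[OF bounded_clinear_bounded_linear[OF A]]
        bounded_linear_compose[OF bounded_clinear_bounded_linear[OF B]]
        bounded_linear_compose[OF bounded_clinear_bounded_linear[OF C]]
        bounded_linear_fst bounded_linear_snd)
  show "\<forall>a x. upper_op A C B (a *\<^sub>C x) = a *\<^sub>C upper_op A C B x"
    using A B C by (simp add: eq scaleC_prod_def bounded_clinear_simps scaleC_add_right)
qed

text \<open>The dimension count of the snake lemma. The six terms of the exact sequence split into four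
  short pieces through \<open>n = dim (snd N(M))\<close>, \<open>q = dim (R(A) + C N(B))/R(A)\<close> and
  \<open>s = dim X/(R(A) + C N(B))\<close>. The sums are taken in \<open>enat\<close>, so that infinite nullities are included.\<close>

lemma upper_op_dimensions:
  fixes A :: "'a::complex_banach \<Rightarrow> 'a" and B :: "'b::complex_banach \<Rightarrow> 'b"
  assumes A: "bounded_clinear A" and B: "bounded_clinear B" and C: "bounded_clinear C"
  obtains n q s where
    "rel_dim ((\<lambda>x. (x, 0)) ` kernel A) (kernel (upper_op A C B)) = n"
    "nullity (upper_op A C B) = nullity A + n" "nullity B = n + q"
    "deficiency A = q + s" "deficiency (upper_op A C B) = s + deficiency B"
proof -
  define M where "M = upper_op A C B"
  have M: "bounded_clinear M" unfolding M_def by (rule bounded_clinear_upper_op[OF A B C])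
  have Mxy: "M (x, y) = (A x + C y, B y)" for x y by (simp add: M_def upper_op_def)
  let ?J = "\<lambda>x::'a. (x, 0::'b)"
  note Alin = bounded_clinear_simps[OF A] and Blin = bounded_clinear_simps[OF B]
    and Clin = bounded_clinear_simps[OF C] and J = bounded_clinear_Pair_0
  have s0: "csubspace {0 :: 'c::complex_normed_vector}" by (simp add: complex_vector.subspace_def)
  define K where "K = ?J ` kernel A"
  define N where "N = snd ` kernel M"
  define S where "S = ?J -` range M"
  define R :: "('a \<times> 'b) set" where "R = snd -` range B"
  have K: "csubspace K" unfolding K_def by (intro csubspace_image J csubspace_kernel A)
  have N: "csubspace N" unfolding N_def by (intro csubspace_image bounded_clinear_snd csubspace_kernel M)
  have S: "csubspace S" unfolding S_def by (intro csubspace_vimage J csubspace_range M)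
  have R: "csubspace R" unfolding R_def by (intro csubspace_vimage bounded_clinear_snd csubspace_range B)
  have KM: "K \<subseteq> kernel M" by (auto simp: K_def kernel_def Mxy Clin Blin zero_prod_def)
  have KN: "snd -` {0} \<inter> kernel M = K"
    by (auto simp: K_def kernel_def Mxy Clin Blin zero_prod_def)
  have N_eq: "N = C -` range A \<inter> kernel B"
  proof (intro equalityI subsetI)
    fix y assume "y \<in> N"
    then obtain x where "A x + C y = 0" "B y = 0"
      by (auto simp: N_def kernel_def Mxy zero_prod_def)
    then have "C y = A (- x)" by (simp add: Alin eq_neg_iff_add_eq_0 add.commute)
    then show "y \<in> C -` range A \<inter> kernel B" using \<open>B y = 0\<close> by (auto simp: kernel_def)
  next
    fix y assume "y \<in> C -` range A \<inter> kernel B"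
    then obtain x where "C y = A x" "B y = 0" by (auto simp: kernel_def)
    then have "(- x, y) \<in> kernel M" by (simp add: kernel_def Mxy Alin zero_prod_def)
    then show "y \<in> N" unfolding N_def by force
  qed
  have S_eq: "S = cspan (range A \<union> C ` kernel B)"
  proof (rule antisym)
    show "S \<subseteq> cspan (range A \<union> C ` kernel B)"
    proof
      fix x assume "x \<in> S"
      then obtain a k where "x = A a + C k" "B k = 0" by (auto simp: S_def Mxy)
      moreover from this have "A a \<in> range A \<union> C ` kernel B" "C k \<in> range A \<union> C ` kernel B"
        by (auto simp: kernel_def)
      ultimately show "x \<in> cspan (range A \<union> C ` kernel B)"
        by (auto intro: complex_vector.span_add complex_vector.span_base)
    qed
    have "A a \<in> S" for a
    proof -
      have "(A a, 0) = M (a, 0)" by (simp add: Mxy Clin Blin)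
      then show ?thesis unfolding S_def by blast
    qed
    moreover have "C k \<in> S" if "k \<in> kernel B" for k
    proof -
      have "(C k, 0) = M (0, k)" using that by (simp add: Mxy Alin kernel_def)
      then show ?thesis unfolding S_def by blast
    qed
    ultimately show "cspan (range A \<union> C ` kernel B) \<subseteq> S"
      by (intro complex_vector.span_minimal[OF _ S]) auto
  qed
  have MR: "range M \<subseteq> R" by (auto simp: R_def Mxy)
  have R_eq: "R = cspan (range M \<union> range ?J)"
  proof (rule antisym)
    show "R \<subseteq> cspan (range M \<union> range ?J)"
    proof
      fix p assume "p \<in> R"
      then obtain x y where p: "p = (x, B y)" by (cases p) (auto simp: R_def)
      have "p = M (0, y) + ?J (x - C y)" by (simp add: p Mxy Alin)
      then show "p \<in> cspan (range M \<union> range ?J)"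
        by (auto intro!: complex_vector.span_add intro: complex_vector.span_base)
    qed
    have "?J x \<in> R" for x unfolding R_def using Blin(4) by (auto intro: rangeI[of B 0, simplified])
    then show "cspan (range M \<union> range ?J) \<subseteq> R"
      using MR by (intro complex_vector.span_minimal[OF _ R]) auto
  qed
  have "rel_dim K (kernel M) = rel_dim {0} N"
    unfolding N_def rel_dim_image[OF bounded_clinear_snd s0]
    using rel_dim_Int[OF csubspace_kernel[OF M], of "snd -` {0}"] KN by simp
  moreover have "nullity M = nullity A + rel_dim K (kernel M)"
  proof -
    have "?J -` {0} = {0}" by (auto simp: zero_prod_def)
    then have "rel_dim {0} K = rel_dim {0} (kernel A)"
      unfolding K_def rel_dim_image[OF J s0] by simp
    moreover have "{0} \<subseteq> K" using complex_vector.subspace_0[OF K] by simp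
    ultimately show ?thesis
      using rel_dim_trans[OF s0 K _ KM] by (simp add: nullity_eq_rel_dim A M)
  qed
  moreover have "nullity B = rel_dim {0} N + rel_dim (range A) (C ` kernel B)"
  proof -
    have "rel_dim (range A) (C ` kernel B) = rel_dim N (kernel B)"
      unfolding rel_dim_image[OF C csubspace_range[OF A]] N_eq
      by (rule rel_dim_Int[OF csubspace_kernel[OF B], symmetric])
    moreover have "{0} \<subseteq> N" "N \<subseteq> kernel B" using complex_vector.subspace_0[OF N] N_eq by auto
    ultimately show ?thesis
      using rel_dim_trans[OF s0 N, of "kernel B"] by (simp add: nullity_eq_rel_dim B)
  qed
  moreover have "deficiency A = rel_dim (range A) (C ` kernel B) + rel_dim S UNIV"
  proof -
    have "range A \<subseteq> S" unfolding S_eq by (auto intro: complex_vector.span_base)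
    moreover have "rel_dim (range A) S = rel_dim (range A) (C ` kernel B)"
      unfolding S_eq by (rule rel_dim_span_Un[OF csubspace_range[OF A]])
    ultimately show ?thesis
      using rel_dim_trans[OF csubspace_range[OF A] S, of UNIV] by (simp add: deficiency_eq_rel_dim A)
  qed
  moreover have "deficiency M = rel_dim S UNIV + deficiency B"
  proof -
    have "rel_dim (range M) R = rel_dim (range M) (range ?J)"
      unfolding R_eq by (rule rel_dim_span_Un[OF csubspace_range[OF M]])
    also have "\<dots> = rel_dim S UNIV"
      unfolding S_def by (rule rel_dim_image[OF J csubspace_range[OF M]])
    finally have "rel_dim (range M) R = rel_dim S UNIV" .
    moreover have "rel_dim R UNIV = rel_dim (range B) UNIV"
      using rel_dim_image[OF bounded_clinear_snd csubspace_range[OF B], of "UNIV :: ('a \<times> 'b) set"] by (simp add: R_def)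
    ultimately show ?thesis
      using rel_dim_trans[OF csubspace_range[OF M] R MR, of UNIV] by (simp add: deficiency_eq_rel_dim M B)
  qed
  ultimately show thesis using that unfolding K_def M_def by metis
qed

lemma closed_complemented_Pair_0_iff:
  fixes N :: "'a::complex_normed_vector set"
  shows "closed_complemented ((\<lambda>x. (x, 0 :: 'b::complex_normed_vector)) ` N) \<longleftrightarrow> closed_complemented N"
proof -
  let ?J = "\<lambda>x::'a. (x, 0::'b)"
  have J: "?J ` N = N \<times> {0}" by auto
  show ?thesis
  proof
    assume L: "closed_complemented (?J ` N)"
    then obtain W where W: "csubspace W" "closed W" "?J ` N \<inter> W = {0}" "?J ` N + W = UNIV"
      by (auto simp: closed_complemented_def)
    have cont: "continuous_on UNIV ?J" by (intro continuous_intros)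
    have "closed (?J -` W)" "closed (?J -` (?J ` N))"
      using continuous_on_closed_vimage[THEN iffD1, OF closed_UNIV cont] W(2) L
      by (auto simp: closed_complemented_def)
    moreover have "?J -` (?J ` N) = N" by auto
    moreover have "csubspace (?J -` W)" by (rule csubspace_vimage[OF bounded_clinear_Pair_0 W(1)])
    moreover have "N \<inter> ?J -` W = {0}" using W(3) by (auto simp: zero_prod_def)
    moreover have "N + ?J -` W = UNIV"
    proof -
      have "x \<in> N + ?J -` W" for x
      proof -
        have "?J x \<in> ?J ` N + W" using W(4) by simp
        then obtain n w where nw: "n \<in> N" "w \<in> W" "?J x = ?J n + w" by (auto elim!: set_plus_elim)
        then have "w = ?J (x - n)" by (cases w) auto
        then have "x - n \<in> ?J -` W" using nw by simp
        then have "n + (x - n) \<in> N + ?J -` W" using nw(1) by (intro set_plus_intro)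
        then show ?thesis by simp
      qed
      then show ?thesis by auto
    qed
    ultimately show "closed_complemented N" unfolding closed_complemented_def by metis
  next
    assume "closed_complemented N"
    then obtain W where N: "closed N" and W: "csubspace W" "closed W" "N \<inter> W = {0}" "N + W = UNIV"
      by (auto simp: closed_complemented_def)
    let ?W = "fst -` W :: ('a \<times> 'b) set"
    have "csubspace ?W" by (rule csubspace_vimage[OF bounded_clinear_fst W(1)])
    moreover have "closed ?W"
      using W(2) by (rule closed_vimage_fst)
    moreover have "?J ` N \<inter> ?W = {0}"
    proof -
      have "?J ` N \<inter> ?W = ?J ` (N \<inter> W)" by auto
      then show ?thesis using W(3) by (simp add: zero_prod_def)
    qed
    moreover have "?J ` N + ?W = UNIV"
    proof -
      have "p \<in> ?J ` N + ?W" for p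
      proof -
        have "fst p \<in> N + W" using W(4) by simp
        then obtain n w where nw: "n \<in> N" "w \<in> W" "fst p = n + w" by (rule set_plus_elim)
        then have "?J n + (w, snd p) \<in> ?J ` N + ?W" by (intro set_plus_intro) auto
        then show ?thesis using nw by (cases p) simp
      qed
      then show ?thesis by auto
    qed
    moreover have "closed (?J ` N)" unfolding J using N by (intro closed_Times) auto
    ultimately show "closed_complemented (?J ` N)" unfolding closed_complemented_def by metis
  qed
qed

text \<open>The kernel of the triangular operator is an extension of \<open>N(A) \<oplus> 0\<close> by a subspace of \<open>N(B)\<close>,
  which has finite dimension.\<close>

lemma closed_complemented_kernel_upper_op_iff:
  fixes A :: "'a::complex_banach \<Rightarrow> 'a" and B :: "'b::complex_banach \<Rightarrow> 'b"
  assumes A: "bounded_clinear A" and B: "bounded_clinear B" and C: "bounded_clinear C"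
    and fin: "nullity B < \<infinity>"
  shows "closed_complemented (kernel (upper_op A C B)) \<longleftrightarrow> closed_complemented (kernel A)"
proof -
  let ?M = "upper_op A C B" and ?K = "(\<lambda>x. (x, 0 :: 'b)) ` kernel A"
  have M: "bounded_clinear ?M" by (rule bounded_clinear_upper_op[OF A B C])
  have fin': "rel_dim ?K (kernel ?M) \<noteq> \<infinity>"
    using upper_op_dimensions[OF A B C] fin by (metis enat_ord_simps(4) plus_enat_simps(2))
  have K: "csubspace ?K" by (intro csubspace_image bounded_clinear_Pair_0 csubspace_kernel A)
  have eq: "?K = kernel A \<times> {0}" by auto
  have clK: "closed ?K" unfolding eq by (intro closed_Times closed_kernel A) auto
  have KM: "?K \<subseteq> kernel ?M"
    by (auto simp: kernel_def upper_op_def bounded_clinear_simps[OF B] bounded_clinear_simps[OF C] zero_prod_def)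
  have "closed_complemented (kernel ?M) \<longleftrightarrow> closed_complemented ?K"
    using closed_complemented_mono_finite[OF K _ csubspace_kernel[OF M] closed_kernel[OF M] KM fin']
      closed_complemented_antimono_finite[OF K clK csubspace_kernel[OF M] _ KM fin'] by blast
  then show ?thesis by (simp add: closed_complemented_Pair_0_iff)
qed

section \<open>Semi-Weyl spectra of triangular operators\<close>

lemma index_nonneg_iff:
  assumes "deficiency T < \<infinity>" shows "index T \<ge> 0 \<longleftrightarrow> deficiency T \<le> nullity T"
  using assms unfolding index_def by (cases "deficiency T"; cases "nullity T") auto

lemma Phi_minus_plus_iff:
  "T \<in> Phi_minus_plus \<longleftrightarrow> bounded_clinear T \<and> deficiency T < \<infinity> \<and> deficiency T \<le> nullity T"
  unfolding Phi_minus_plus_def Phi_minus_def using index_nonneg_iff by auto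

lemma Phi_rw_iff: "T \<in> Phi_rw \<longleftrightarrow> T \<in> Phi_minus_plus \<and> closed_complemented (kernel T)"
  unfolding Phi_rw_def Phi_r_def Phi_minus_plus_def Phi_minus_def by auto

text \<open>The index bookkeeping. From left to right, the SVEP of \<open>B\<close> makes \<open>\<alpha>(B)\<close> finite and \<open>ind B \<le> 0\<close>, hence
  \<open>ind A \<ge> 0\<close>; the alternative hypothesis then excludes \<open>ind B < 0\<close>.\<close>

lemma upper_op_semi_Weyl_iff:
  fixes A :: "'a::complex_banach \<Rightarrow> 'a" and B :: "'b::complex_banach \<Rightarrow> 'b"
  assumes A: "bounded_clinear A" and B: "bounded_clinear B" and C: "bounded_clinear C"
    and svepB: "SVEP_at B 0" and svep: "SVEP_at A 0 \<or> SVEP_at (dual_op B) 0"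
  shows "upper_op A C B \<in> Phi_minus_plus \<longleftrightarrow> A \<in> Phi_minus_plus \<and> B \<in> Phi_minus_plus"
    and "upper_op A C B \<in> Phi_rw \<longleftrightarrow> A \<in> Phi_rw \<and> B \<in> Phi_rw"
proof -
  let ?M = "upper_op A C B"
  have M: "bounded_clinear ?M" by (rule bounded_clinear_upper_op[OF A B C])
  obtain n q s where dims: "nullity ?M = nullity A + n" "nullity B = n + q"
    "deficiency A = q + s" "deficiency ?M = s + deficiency B"
    using upper_op_dimensions[OF A B C] by metis
  have B_le: "nullity B \<le> deficiency B" if "deficiency B < \<infinity>"
    by (rule SVEP_nullity_le_deficiency[OF B svepB that])
  show *: "?M \<in> Phi_minus_plus \<longleftrightarrow> A \<in> Phi_minus_plus \<and> B \<in> Phi_minus_plus"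
  proof
    assume "?M \<in> Phi_minus_plus"
    then have m: "s + deficiency B < \<infinity>" "s + deficiency B \<le> nullity A + n"
      by (auto simp: Phi_minus_plus_iff dims)
    then obtain s' b where sb: "s = enat s'" "deficiency B = enat b"
      by (cases s; cases "deficiency B") auto
    then obtain n' q' where nq: "n = enat n'" "q = enat q'" "n' + q' \<le> b"
      using B_le dims(2) by (cases n; cases q) auto
    have A': "deficiency A \<le> nullity A"
      using m(2) nq sb dims(3) by (cases "nullity A") auto
    moreover have "deficiency B \<le> nullity B"
      using svep
    proof
      assume "SVEP_at A 0"
      then have "nullity A \<le> deficiency A"
        using SVEP_nullity_le_deficiency[OF A] dims(3) nq sb by simp
      then show ?thesis using m(2) nq sb dims by (cases "nullity A") auto
    next
      assume "SVEP_at (dual_op B) 0"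
      then show ?thesis
        using dual_SVEP_deficiency_le_nullity[OF B] dims(2) nq sb by simp
    qed
    ultimately show "A \<in> Phi_minus_plus \<and> B \<in> Phi_minus_plus"
      using A B dims(3) nq sb by (simp add: Phi_minus_plus_iff)
  next
    assume "A \<in> Phi_minus_plus \<and> B \<in> Phi_minus_plus"
    then have "deficiency A < \<infinity>" "deficiency A \<le> nullity A"
      "deficiency B < \<infinity>" "deficiency B \<le> nullity B" by (auto simp: Phi_minus_plus_iff)
    then show "?M \<in> Phi_minus_plus"
      using M unfolding Phi_minus_plus_iff dims
      by (cases s; cases q; cases n; cases "nullity A"; cases "deficiency B") auto
  qed
  have fin: "nullity B < \<infinity>" if "B \<in> Phi_minus_plus"
    using that B_le unfolding Phi_minus_plus_iff by (metis le_less_trans)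
  show "?M \<in> Phi_rw \<longleftrightarrow> A \<in> Phi_rw \<and> B \<in> Phi_rw"
  proof (cases "A \<in> Phi_minus_plus \<and> B \<in> Phi_minus_plus")
    case True
    have "closed_complemented (kernel B)"
    proof (intro closed_complemented_finite_dim csubspace_kernel closed_kernel B)
      show "rel_dim {0} (kernel B) \<noteq> \<infinity>"
        using fin True nullity_eq_rel_dim[OF B] by (metis less_irrefl)
    qed
    then show ?thesis
      using True * closed_complemented_kernel_upper_op_iff[OF A B C] fin by (simp add: Phi_rw_iff)
  qed (use * in \<open>auto simp: Phi_rw_iff\<close>)
qed

theorem theorem3p6:
  fixes A :: "'a::complex_banach \<Rightarrow> 'a"
    and B :: "'b::complex_banach \<Rightarrow> 'b"
    and C :: "'b \<Rightarrow> 'a"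
  assumes "cdim (UNIV :: 'a set) = \<infinity>"
    and "cdim (UNIV :: 'b set) = \<infinity>"
    and "bounded_clinear A"
    and "bounded_clinear B"
    and "bounded_clinear C"
  shows "sigma_sw (upper_op A C B) \<union> (SVEP_fail A \<inter> SVEP_fail (dual_op B)) \<union> SVEP_fail B
      = sigma_sw A \<union> sigma_sw B \<union> (SVEP_fail A \<inter> SVEP_fail (dual_op B)) \<union> SVEP_fail B \<and>
    sigma_rw (upper_op A C B) \<union> (SVEP_fail A \<inter> SVEP_fail (dual_op B)) \<union> SVEP_fail B
      = sigma_rw A \<union> sigma_rw B \<union> (SVEP_fail A \<inter> SVEP_fail (dual_op B)) \<union> SVEP_fail B"
proof -
  note A = \<open>bounded_clinear A\<close> and B = \<open>bounded_clinear B\<close> and C = \<open>bounded_clinear C\<close>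
  let ?E = "(SVEP_fail A \<inter> SVEP_fail (dual_op B)) \<union> SVEP_fail B"
  have key: "(l \<in> sigma_sw (upper_op A C B) \<longleftrightarrow> l \<in> sigma_sw A \<union> sigma_sw B) \<and>
      (l \<in> sigma_rw (upper_op A C B) \<longleftrightarrow> l \<in> sigma_rw A \<union> sigma_rw B)" if "l \<notin> ?E" for l
  proof -
    let ?A = "\<lambda>x. A x - l *\<^sub>C x" and ?B = "\<lambda>x. B x - l *\<^sub>C x"
    have "SVEP_at ?B 0" "SVEP_at ?A 0 \<or> SVEP_at (dual_op ?B) 0"
      using that by (auto simp: SVEP_fail_def dual_op_shift[OF B] intro: SVEP_at_shift)
    moreover have "(\<lambda>p. upper_op A C B p - l *\<^sub>C p) = upper_op ?A C ?B"
      by (auto simp: upper_op_def scaleC_prod_def)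
    ultimately show ?thesis
      using upper_op_semi_Weyl_iff[OF bounded_clinear_shift[OF A] bounded_clinear_shift[OF B] C]
      by (simp add: sigma_sw_def sigma_rw_def)
  qed
  then show ?thesis by blast
qed

end
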